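(* Let $G=(V\cup P,E)$ be the graph of a rectangular parallel-aisle warehouse with $m\ge 1$ vertical aisles and $n\ge 2$ horizontal cross-aisles, where $P=\{p_0,p_1,\dots,p_k\}$ is the set of locations to be visited. Then there exists a minimum length tour subgraph $T\subseteq G$ that does not contain a connecting double edge.
   Context: **Warehouse graph.** Let $m\ge 1$ and $n\ge 2$. The vertex set $V=\{v_{i,j}: 1\le i\le m,\ 1\le j\le n\}$ consists of the intersections of aisle $i$ (vertical) with cross-aisle $j$ (horizontal). For $1\le i\le m$ and $1\le j<n$, the subaisle between $v_{i,j}$ and $v_{i,j+1}$ is the section of aisle $i$ between cross-aisles $j$ and $j+1$. The set $P=\{p_0,p_1,\dots,p_k\}$ is the set of locations to be visited: $p_0$ is the depot and $p_1,\dots,p_k$ are the products. The depot $p_0$ may coincide with a vertex $v_{i,j}$. All other points of $P$ (and $p_0$, if it is not one of the $v_{i,j}$) lie in the interior of subaisles. $G=(V\cup P,E)$ is an undirected multigraph in which every link below is represented by exactly two parallel edges of the same length: - Horizontal links: between $v_{i,j}$ and $v_{i+1,j}$ for $1\le i<m$, $1\le j\le n$. Each has length $d^{\mathrm{cross}}_{i,i+1}>0$, independent of $j$. - Vertical links: in each subaisle, the points $v_{i,j}$, the points of $P$ in that subaisle in order of position, and $v_{i,j+1}$ form a path, and consecutive points on this path are linked. The link lengths are the (nonnegative) distances between consecutive points, and in each subaisle they sum to $d^{\mathrm{aisle}}_{j,j+1}>0$, independent of $i$. There are no other edges. (The rectangular assumption is that these lengths do not depend on $j$ and on $i$, respectively.)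 **Tour subgraph.** A subgraph $T\subseteq G$ (so each link is used $0$, $1$ or $2$ times) that contains all points of $P$ is a tour subgraph if it contains a tour, i.e. a closed walk visiting all vertices of $T$, that uses every edge of $T$ exactly once. Equivalently, $T$ contains all vertices of $P$, is connected, and every vertex of $T$ has even degree in $T$. The length of $T$ is the sum of the lengths of its edges counted with multiplicity. A minimum length tour subgraph is a tour subgraph of smallest length among all tour subgraphs of $G$. **Edge multiplicities.** For a subgraph $T$, $m(v_{i,j},v_{i+1,j})\in\{0,1,2\}$ is the number of edges of $T$ between $v_{i,j}$ and $v_{i+1,j}$, with the convention that $m(v_{0,j},v_{1,j})=m(v_{m,j},v_{m+1,j})=0$. The subaisle between $v_{i,l}$ and $v_{i,l+1}$ is said to contain a single edge (respectively, a double edge), written $m(v_{i,l},v_{i,l+1})=1$ (respectively, $=2$), if every vertical link of that subaisle, through all the points of $P$ lying in it, is used exactly once (respectively, exactly twice) in $T$. **Double edges.** For $1\le i\le m$ and $1\le j<k\le n$, $T$ contains the double edge $(v_{i,j},v_{i,k})^2$ if 1. $m(v_{i,l},v_{i,l+1})=2$ for all $j\le l<k$, and 2. $m(v_{i-1,l},v_{i,l})+m(v_{i,l},v_{i+1,l})=0$ for all $j<l<k$. The double edge $(v_{i,j},v_{i,k})^2$ is called connecting if, in addition, 1. $m(v_{i-1,j},v_{i,j})+m(v_{i,j},v_{i+1,j})>0$, and 2. $m(v_{i-1,k},v_{i,k})+m(v_{i,k},v_{i+1,k})>0$. That is, each of its two end vertices has at least one incident horizontal edge in $T$. Thus $T$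 contains no connecting double edge if there are no $i$ and $j<k$ such that $(v_{i,j},v_{i,k})^2$ is a connecting double edge of $T$. *)

theory Defs
  imports Complex_Main
begin

section \<open>Undirected multigraphs\<close>

text \<open>Edges are named objects, so parallel edges are distinct edges with the same set of ends.\<close>

record ('v, 'e) mgraph =
  verts :: "'v set"
  edges :: "'e set"
  ends :: "'e \<Rightarrow> 'v set"

definition subgraph :: "('v, 'e) mgraph \<Rightarrow> ('v, 'e) mgraph \<Rightarrow> bool" where
  "subgraph H G \<longleftrightarrow>
     verts H \<subseteq> verts G \<and> edges H \<subseteq> edges G \<and> ends H = ends G \<and>
     (\<forall>e\<in>edges H. ends H e \<subseteq> verts H)"

definition walk :: "('v, 'e) mgraph \<Rightarrow> 'v list \<Rightarrow> 'e list \<Rightarrow> bool" where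
  "walk H vs es \<longleftrightarrow>
     length vs = Suc (length es) \<and> set vs \<subseteq> verts H \<and> set es \<subseteq> edges H \<and>
     (\<forall>s<length es. ends H (es ! s) = {vs ! s, vs ! Suc s})"

text \<open>A closed walk through all vertices that uses every edge exactly once.
  The walk may have length 0, which covers a graph with one vertex and no edge.\<close>

definition tour :: "('v, 'e) mgraph \<Rightarrow> 'v list \<Rightarrow> 'e list \<Rightarrow> bool" where
  "tour H vs es \<longleftrightarrow>
     walk H vs es \<and> hd vs = last vs \<and> set vs = verts H \<and>
     distinct es \<and> set es = edges H"

definition mult :: "('v, 'e) mgraph \<Rightarrow> 'v \<Rightarrow> 'v \<Rightarrow> nat" where
  "mult H u v = card {e \<in> edges H. ends H e = {u, v}}"

section \<open>Rectangular parallel-aisle warehouses\<close>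

text \<open>\<open>At_Crossing i j\<close> is the intersection of aisle \<open>i\<close> with cross-aisle \<open>j\<close>;
  \<open>In_Subaisle i j\<close> is the interior of the section of aisle \<open>i\<close> between the
  cross-aisles \<open>j\<close> and \<open>j + 1\<close>.\<close>

datatype site = At_Crossing nat nat | In_Subaisle nat nat

text \<open>
  The locations to be visited are numbered \<open>0, \<dots>, last_loc\<close>, number 0 being the depot.
  \<open>cross_len i\<close> is the distance between the aisles \<open>i\<close> and \<open>i + 1\<close>, on every cross-aisle;
  \<open>aisle_len j\<close> is the distance between the cross-aisles \<open>j\<close> and \<open>j + 1\<close>, on every aisle.
  For a location \<open>t\<close> with site \<open>In_Subaisle i j\<close>, \<open>pos t\<close> is its distance from cross-aisle \<open>j\<close>;
  for a depot at a crossing it is irrelevant.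
  \<open>locs i j\<close> lists the locations in a subaisle in order of position. It is a component of
  its own because several locations may share a position, and then any order among
  them is allowed.
\<close>

record warehouse =
  aisles :: nat
  cross_aisles :: nat
  last_loc :: nat
  cross_len :: "nat \<Rightarrow> real"
  aisle_len :: "nat \<Rightarrow> real"
  site :: "nat \<Rightarrow> site"
  pos :: "nat \<Rightarrow> real"
  locs :: "nat \<Rightarrow> nat \<Rightarrow> nat list"

definition is_crossing :: "warehouse \<Rightarrow> nat \<Rightarrow> nat \<Rightarrow> bool" where
  "is_crossing W i j \<longleftrightarrow> 1 \<le> i \<and> i \<le> aisles W \<and> 1 \<le> j \<and> j \<le> cross_aisles W"

definition is_subaisle :: "warehouse \<Rightarrow> nat \<Rightarrow> nat \<Rightarrow> bool" where
  "is_subaisle W i j \<longleftrightarrow> 1 \<le> i \<and> i \<le> aisles W \<and> 1 \<le> j \<and> j < cross_aisles W"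

definition in_subaisle :: "warehouse \<Rightarrow> nat \<Rightarrow> bool" where
  "in_subaisle W t \<longleftrightarrow>
     (\<exists>i j. is_subaisle W i j \<and> site W t = In_Subaisle i j \<and> 0 < pos W t \<and> pos W t < aisle_len W j)"

definition rectangular_warehouse :: "warehouse \<Rightarrow> bool" where
  "rectangular_warehouse W \<longleftrightarrow>
     1 \<le> aisles W \<and> 2 \<le> cross_aisles W \<and>
     (\<forall>i. 1 \<le> i \<and> i < aisles W \<longrightarrow> 0 < cross_len W i) \<and>
     (\<forall>j. 1 \<le> j \<and> j < cross_aisles W \<longrightarrow> 0 < aisle_len W j) \<and>
     ((\<exists>i j. is_crossing W i j \<and> site W 0 = At_Crossing i j) \<or> in_subaisle W 0) \<and>
     (\<forall>t. 1 \<le> t \<and> t \<le> last_loc W \<longrightarrow> in_subaisle W t) \<and>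
     (\<forall>i j. is_subaisle W i j \<longrightarrow>
        distinct (locs W i j) \<and>
        set (locs W i j) = {t. t \<le> last_loc W \<and> site W t = In_Subaisle i j} \<and>
        sorted (map (pos W) (locs W i j)))"

section \<open>The warehouse graph\<close>

datatype node = Crossing nat nat | Stop nat

text \<open>\<open>HLink i j\<close> joins the crossings of aisles \<open>i\<close> and \<open>i + 1\<close> on cross-aisle \<open>j\<close>.
  \<open>VLink i j s\<close> is the \<open>s\<close>-th link, counted from 0, of the path through subaisle \<open>(i, j)\<close>.\<close>

datatype link = HLink nat nat | VLink nat nat nat

text \<open>The flag distinguishes the two parallel edges that represent a link.\<close>

type_synonym edge = "link \<times> bool"

fun site_node :: "site \<Rightarrow> nat \<Rightarrow> node" where
  "site_node (At_Crossing i j) t = Crossing i j"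
| "site_node (In_Subaisle i j) t = Stop t"

definition loc_nodes :: "warehouse \<Rightarrow> node set" where
  "loc_nodes W = (\<lambda>t. site_node (site W t) t) ` {0..last_loc W}"

definition crossing_nodes :: "warehouse \<Rightarrow> node set" where
  "crossing_nodes W = {Crossing i j | i j. is_crossing W i j}"

definition subaisle_path :: "warehouse \<Rightarrow> nat \<Rightarrow> nat \<Rightarrow> node list" where
  "subaisle_path W i j = Crossing i j # map Stop (locs W i j) @ [Crossing i (Suc j)]"

definition subaisle_positions :: "warehouse \<Rightarrow> nat \<Rightarrow> nat \<Rightarrow> real list" where
  "subaisle_positions W i j = 0 # map (pos W) (locs W i j) @ [aisle_len W j]"

definition links :: "warehouse \<Rightarrow> link set" where
  "links W =
     {HLink i j | i j. 1 \<le> i \<and> i < aisles W \<and> 1 \<le> j \<and> j \<le> cross_aisles W} \<union>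
     {VLink i j s | i j s. is_subaisle W i j \<and> s \<le> length (locs W i j)}"

fun link_ends :: "warehouse \<Rightarrow> link \<Rightarrow> node set" where
  "link_ends W (HLink i j) = {Crossing i j, Crossing (Suc i) j}"
| "link_ends W (VLink i j s) = {subaisle_path W i j ! s, subaisle_path W i j ! Suc s}"

fun link_len :: "warehouse \<Rightarrow> link \<Rightarrow> real" where
  "link_len W (HLink i j) = cross_len W i"
| "link_len W (VLink i j s) = subaisle_positions W i j ! Suc s - subaisle_positions W i j ! s"

definition warehouse_graph :: "warehouse \<Rightarrow> (node, edge) mgraph" where
  "warehouse_graph W =
     \<lparr> verts = crossing_nodes W \<union> loc_nodes W,
       edges = links W \<times> UNIV,
       ends = (\<lambda>e. link_ends W (fst e)) \<rparr>"

section \<open>Tour subgraphs\<close>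

definition tour_subgraph :: "warehouse \<Rightarrow> (node, edge) mgraph \<Rightarrow> bool" where
  "tour_subgraph W T \<longleftrightarrow>
     subgraph T (warehouse_graph W) \<and> loc_nodes W \<subseteq> verts T \<and> (\<exists>vs es. tour T vs es)"

definition total_len :: "warehouse \<Rightarrow> (node, edge) mgraph \<Rightarrow> real" where
  "total_len W T = (\<Sum>e\<in>edges T. link_len W (fst e))"

definition minimum_tour_subgraph :: "warehouse \<Rightarrow> (node, edge) mgraph \<Rightarrow> bool" where
  "minimum_tour_subgraph W T \<longleftrightarrow>
     tour_subgraph W T \<and> (\<forall>T'. tour_subgraph W T' \<longrightarrow> total_len W T \<le> total_len W T')"

section \<open>Double edges\<close>

text \<open>The number of horizontal edges of \<open>T\<close> at a crossing. For \<open>i = 1\<close> and \<open>i = aisles W\<close> the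
  summand that refers to aisle \<open>0\<close> or \<open>aisles W + 1\<close> is 0, because the warehouse graph
  has no such crossing.\<close>

definition horizontal_count :: "(node, edge) mgraph \<Rightarrow> nat \<Rightarrow> nat \<Rightarrow> nat" where
  "horizontal_count T i j =
     mult T (Crossing (i - 1) j) (Crossing i j) + mult T (Crossing i j) (Crossing (Suc i) j)"

definition subaisle_double :: "warehouse \<Rightarrow> (node, edge) mgraph \<Rightarrow> nat \<Rightarrow> nat \<Rightarrow> bool" where
  "subaisle_double W T i l \<longleftrightarrow>
     (\<forall>s\<le>length (locs W i l).
        mult T (subaisle_path W i l ! s) (subaisle_path W i l ! Suc s) = 2)"

definition double_edge :: "warehouse \<Rightarrow> (node, edge) mgraph \<Rightarrow> nat \<Rightarrow> nat \<Rightarrow> nat \<Rightarrow> bool" where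
  "double_edge W T i j k \<longleftrightarrow>
     1 \<le> i \<and> i \<le> aisles W \<and> 1 \<le> j \<and> j < k \<and> k \<le> cross_aisles W \<and>
     (\<forall>l. j \<le> l \<and> l < k \<longrightarrow> subaisle_double W T i l) \<and>
     (\<forall>l. j < l \<and> l < k \<longrightarrow> horizontal_count T i l = 0)"

definition connecting_double_edge ::
    "warehouse \<Rightarrow> (node, edge) mgraph \<Rightarrow> nat \<Rightarrow> nat \<Rightarrow> nat \<Rightarrow> bool" where
  "connecting_double_edge W T i j k \<longleftrightarrow>
     double_edge W T i j k \<and> 0 < horizontal_count T i j \<and> 0 < horizontal_count T i k"

end

theory Submission
  imports Defs
begin

text \<open>
  Tour subgraphs are, by Euler's theorem, the connected subgraphs with even degrees that contain
  all locations. Up to the choice between parallel edges such a subgraph is given by the number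
  of edges, \<open>0\<close>, \<open>1\<close> or \<open>2\<close>, that it uses on each link; there are finitely many choices, and
  using every link twice is one of them, so minimum length tour subgraphs exist.

  Let \<open>T\<close> be of minimum length with a double edge in aisle \<open>i\<close> between the cross-aisles \<open>j\<close> and \<open>k\<close>,
  and suppose that there is a horizontal edge from one of its ends, on cross-aisle \<open>e \<in> {j, k}\<close>,
  to a neighbouring aisle \<open>i'\<close>. Let \<open>f\<close> be the other one of \<open>j\<close> and \<open>k\<close>. Change \<open>T\<close> along the
  boundary of the rectangle spanned by \<open>i, i', j, k\<close>: remove one edge from every link of the
  double edge and one edge between the two aisles on cross-aisle \<open>e\<close>, and add one edge between
  them on cross-aisle \<open>f\<close> and one edge to every link of aisle \<open>i'\<close> between \<open>j\<close> and \<open>k\<close>,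
  where three parallel edges are reduced to one. As the boundary is a cycle, the degrees stay
  even. At most the link on cross-aisle \<open>e\<close> becomes unused, and the rest of the boundary joins its
  ends, so the graph stays connected (\<open>feasible_flip\<close>). As the warehouse is rectangular, the
  length does not increase (\<open>count_len_flip\<close>). Completely doubled subaisles disappear from aisle \<open>i\<close>
  between \<open>j\<close> and \<open>k\<close>, and in aisle \<open>i'\<close> they arise only from subaisles with a single edge.

  Weight every doubled subaisle of aisle \<open>i\<close> by \<open>n + m - i\<close>, and choose \<open>T\<close> among the minimum
  length tour subgraphs with the least total weight. A flip to the right would lower the weight, so
  neither end of a connecting double edge has a horizontal edge to the right; hence both have one
  to the left. A flip to the left would lower the weight unless aisle \<open>i - 1\<close> has a single edge
  in all subaisles between \<open>j\<close> and \<open>k\<close>. In that case the whole boundary of the rectangle is used,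
  so that both edges of any one link of the double edge can be removed without disconnecting
  the graph, and choosing a link of positive length contradicts minimality
  (\<open>remove_double_link\<close>).
\<close>

section \<open>Euler's theorem\<close>

text \<open>Adjacency; its reflexive transitive closure expresses connectedness.\<close>

definition adj :: "('v, 'e) mgraph \<Rightarrow> ('v \<times> 'v) set" where
  "adj H = {(x, y). \<exists>e\<in>edges H. ends H e = {x, y}}"

text \<open>Every edge has two distinct ends, both of which are vertices.\<close>

definition loop_free :: "('v, 'e) mgraph \<Rightarrow> bool" where
  "loop_free H \<longleftrightarrow>
     (\<forall>e\<in>edges H. \<exists>x\<in>verts H. \<exists>y\<in>verts H. x \<noteq> y \<and> ends H e = {x, y})"

lemma even_sum_consecutive:
  fixes g :: "nat \<Rightarrow> nat"
  shows "even (\<Sum>s<n. g s + g (Suc s)) \<longleftrightarrow> even (g 0 + g n)"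
  by (induction n) auto

lemma walk_Cons:
  "walk H (u # v # vs) (e # es) \<longleftrightarrow>
     u \<in> verts H \<and> e \<in> edges H \<and> ends H e = {u, v} \<and> walk H (v # vs) es"
  by (auto simp: walk_def All_less_Suc2)

lemma walk_snoc:
  assumes "walk H vs es" "e \<in> edges H" "ends H e = {last vs, y}" "y \<in> verts H"
  shows "walk H (vs @ [y]) (es @ [e])"
proof -
  have l: "length vs = Suc (length es)" using assms(1) by (simp add: walk_def)
  then have "last vs = vs ! length es" by (metis diff_Suc_1 last_conv_nth list.size(3) nat.distinct(1))
  then show ?thesis using assms l by (auto simp: walk_def nth_append less_Suc_eq)
qed

lemma walk_nonempty: "walk H vs es \<Longrightarrow> vs \<noteq> []"
  by (auto simp: walk_def)

text \<open>Along a trail every passage through a vertex uses two edges, so only the two ends of an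
  open trail have odd degree in it.\<close>

lemma even_trail_degree:
  assumes w: "walk H vs es" and d: "distinct es" and lf: "loop_free H"
  shows "even (card {e \<in> set es. v \<in> ends H e}) \<longleftrightarrow> (v = hd vs \<longleftrightarrow> v = last vs)"
proof -
  have l: "length vs = Suc (length es)" using w by (simp add: walk_def)
  have E: "ends H (es ! s) = {vs ! s, vs ! Suc s}" "vs ! s \<noteq> vs ! Suc s" if "s < length es" for s
  proof -
    show *: "ends H (es ! s) = {vs ! s, vs ! Suc s}" using w that by (simp add: walk_def)
    have "es ! s \<in> edges H" using w that by (auto simp: walk_def)
    then obtain x y where "x \<noteq> y" "ends H (es ! s) = {x, y}" using lf by (auto simp: loop_free_def)
    then show "vs ! s \<noteq> vs ! Suc s" using * by auto
  qed
  have "card {e \<in> set es. v \<in> ends H e} = (\<Sum>e\<in>set es. of_bool (v \<in> ends H e))"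
    by (simp add: Int_def)
  also have "\<dots> = (\<Sum>s<length es. of_bool (v \<in> ends H (es ! s)))"
    by (rule sum.reindex_bij_betw[symmetric]) (simp add: bij_betw_nth d)
  also have "\<dots> = (\<Sum>s<length es. of_bool (v = vs ! s) + of_bool (v = vs ! Suc s))"
    by (rule sum.cong) (use E(2) in \<open>force simp: E(1)\<close>)+
  finally have "even (card {e \<in> set es. v \<in> ends H e}) \<longleftrightarrow>
      even (of_bool (v = vs ! 0) + of_bool (v = vs ! length es) :: nat)"
    using even_sum_consecutive[of "\<lambda>s. of_bool (v = vs ! s)" "length es"] by simp
  moreover have "vs ! 0 = hd vs" "vs ! length es = last vs"
    using l by (metis hd_conv_nth list.size(3) nat.distinct(1),
      metis diff_Suc_1 last_conv_nth list.size(3) nat.distinct(1))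
  ultimately show ?thesis by auto
qed

lemma sym_adj: "sym (adj H)"
  by (auto simp: adj_def sym_def insert_commute)

lemma tour_even_degree:
  assumes "tour H vs es" "loop_free H"
  shows "even (card {e \<in> edges H. v \<in> ends H e})"
  using even_trail_degree[of H vs es v] assms by (auto simp: tour_def)

lemma walk_connected:
  assumes "walk H vs es" "x \<in> set vs"
  shows "(hd vs, x) \<in> (adj H)\<^sup>*"
  using assms
proof (induction es arbitrary: vs)
  case Nil
  then show ?case by (cases vs) (auto simp: walk_def)
next
  case (Cons e es)
  then obtain u v ws where vs: "vs = u # v # ws"
    by (cases vs; cases "tl vs") (auto simp: walk_def)
  then have "(u, v) \<in> adj H" "walk H (v # ws) es" using Cons.prems by (auto simp: walk_Cons adj_def)
  then show ?case using Cons.IH[of "v # ws"] Cons.prems vs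
    by (auto intro: converse_rtrancl_into_rtrancl)
qed

lemma tour_connected:
  assumes "tour H vs es" "x \<in> verts H" "y \<in> verts H"
  shows "(x, y) \<in> (adj H)\<^sup>*"
proof -
  have "(hd vs, x) \<in> (adj H)\<^sup>*" "(hd vs, y) \<in> (adj H)\<^sup>*"
    using assms walk_connected[of H vs es] unfolding tour_def by blast+
  then show ?thesis using sym_rtrancl[OF sym_adj, of H] by (meson rtrancl_trans symD)
qed

lemma rotate_closed_walk:
  assumes "walk H vs es" "hd vs = last vs" "distinct es" "x \<in> set vs"
  shows "\<exists>vs' es'. walk H vs' es' \<and> hd vs' = x \<and> last vs' = x \<and> distinct es' \<and>
           set es' = set es \<and> set vs' = set vs"
proof -
  obtain p where "p < length vs" "vs ! p = x" using assms(4) by (auto simp: in_set_conv_nth)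
  with assms(1-3) show ?thesis
  proof (induction p arbitrary: vs es)
    case 0
    then show ?case by (metis hd_conv_nth length_greater_0_conv)
  next
    case (Suc p)
    then obtain u v ws e es' where vs: "vs = u # v # ws" "es = e # es'"
      by (cases vs; cases "tl vs"; cases es) (auto simp: walk_def)
    have w: "walk H (v # ws) es'" "e \<in> edges H" "ends H e = {u, v}" "u \<in> verts H"
      using Suc.prems vs by (auto simp: walk_Cons)
    have lu: "last (v # ws) = u" using Suc.prems vs by simp
    have "walk H ((v # ws) @ [v]) (es' @ [e])"
      using w lu by (intro walk_snoc) (auto simp: walk_def)
    moreover have "((v # ws) @ [v]) ! p = x" "p < length ((v # ws) @ [v])"
      using Suc.prems vs nth_append[of "v # ws" "[v]" p] by auto
    ultimately obtain vs' es'' where "walk H vs' es''" "hd vs' = x" "last vs' = x" "distinct es''"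
        "set es'' = set (es' @ [e])" "set vs' = set ((v # ws) @ [v])"
      using Suc.IH[of "(v # ws) @ [v]" "es' @ [e]"] Suc.prems vs by auto
    moreover have "u \<in> set (v # ws)" using lu last_in_set[of "v # ws"] by auto
    ultimately show ?case using vs by (intro exI[of _ vs'] exI[of _ es'']) auto
  qed
qed

text \<open>A longest trail is closed, since otherwise an unused edge leaves its last vertex. It can be
  rotated to end at any of its vertices, so no unused edge touches it; by connectedness it
  covers the graph.\<close>

theorem euler_tour:
  assumes fin: "finite (edges H)" and lf: "loop_free H"
    and even: "\<And>v. even (card {e \<in> edges H. v \<in> ends H e})"
    and ne: "verts H \<noteq> {}"
    and con: "\<And>x y. x \<in> verts H \<Longrightarrow> y \<in> verts H \<Longrightarrow> (x, y) \<in> (adj H)\<^sup>*"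
  shows "\<exists>vs es. tour H vs es"
proof -
  define trail where "trail n \<longleftrightarrow> (\<exists>vs es. walk H vs es \<and> distinct es \<and> length es = n)" for n
  obtain x0 where "x0 \<in> verts H" using ne by auto
  then have "walk H [x0] []" by (auto simp: walk_def)
  then have t0: "trail 0" unfolding trail_def by (intro exI[of _ "[x0]"] exI[of _ "[]"]) auto
  have bound: "n \<le> card (edges H)" if n: "trail n" for n
  proof -
    obtain vs es where "walk H vs es" "distinct es" "length es = n" using n unfolding trail_def by blast
    then show ?thesis using card_mono[OF fin, of "set es"] by (auto simp: walk_def distinct_card)
  qed
  define N where "N = (GREATEST n. trail n)"
  have tN: "trail N" and mx: "\<And>n. trail n \<Longrightarrow> n \<le> N"
    unfolding N_def using GreatestI_nat[of trail 0] Greatest_le_nat[of trail] t0 bound by blast+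
  obtain vs es where w: "walk H vs es" and d: "distinct es" and len: "length es = N"
    using tN unfolding trail_def by blast
  have extend: False if "walk H vs' es'" "distinct es'" "set es' = set es"
      and e: "e \<in> edges H" "e \<notin> set es" "last vs' \<in> ends H e" for vs' es' e
  proof -
    obtain y where "ends H e = {last vs', y}" "y \<in> verts H"
      using lf e(1,3) unfolding loop_free_def by (smt (verit) empty_iff insert_commute insert_iff)
    then have "walk H (vs' @ [y]) (es' @ [e])" using walk_snoc that e by fast
    moreover have "length es' = N" using that(2,3) d len distinct_card by metis
    ultimately have "trail (Suc N)" unfolding trail_def
      using that e by (intro exI[of _ "vs' @ [y]"] exI[of _ "es' @ [e]"]) auto
    then show False using mx by fastforce
  qed
  have closed: "hd vs = last vs"
  proof (rule ccontr)
    assume "hd vs \<noteq> last vs"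
    then have "odd (card {e \<in> set es. last vs \<in> ends H e})"
      using even_trail_degree[OF w d lf, of "last vs"] by simp
    then have "{e \<in> set es. last vs \<in> ends H e} \<noteq> {e \<in> edges H. last vs \<in> ends H e}"
      using even by metis
    then obtain e where "e \<in> edges H" "e \<notin> set es" "last vs \<in> ends H e"
      using w by (auto simp: walk_def)
    then show False using extend w d by blast
  qed
  have full: "e \<in> set es" if "e \<in> edges H" "x \<in> set vs" "x \<in> ends H e" for e x
    using rotate_closed_walk[OF w closed d that(2)] extend that by metis
  have sub: "set vs \<subseteq> verts H" "set es \<subseteq> edges H" using w by (auto simp: walk_def)
  have step: "y \<in> set vs" if "x \<in> set vs" "(x, y) \<in> adj H" for x y
  proof -
    obtain e where e: "e \<in> edges H" "ends H e = {x, y}" using \<open>(x, y) \<in> adj H\<close> by (auto simp: adj_def)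
    then have "e \<in> set es" using full that by auto
    then obtain s where "s < length es" "es ! s = e" by (auto simp: in_set_conv_nth)
    then have "{x, y} = {vs ! s, vs ! Suc s}" "Suc s < length vs" using w e by (auto simp: walk_def)
    then show ?thesis by (metis Suc_lessD insert_iff nth_mem singletonD)
  qed
  have "hd vs \<in> set vs" using walk_nonempty[OF w] by simp
  have all: "y \<in> set vs" if "y \<in> verts H" for y
  proof -
    have "(hd vs, y) \<in> (adj H)\<^sup>*" using con that sub \<open>hd vs \<in> set vs\<close> by blast
    then show ?thesis using \<open>hd vs \<in> set vs\<close> by (induction rule: rtrancl_induct) (auto intro: step)
  qed
  have "set vs = verts H" using all sub by auto
  moreover have "set es = edges H"
    using full sub lf \<open>set vs = verts H\<close> unfolding loop_free_def by (smt (verit) insertI1 subsetI subset_antisym)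
  ultimately show ?thesis using w d closed unfolding tour_def by blast
qed

section \<open>The links of the warehouse graph\<close>

text \<open>\<open>path i y\<close> is the path through the subaisle \<open>(i, y)\<close>, with \<open>stops i y\<close> locations between
  its two crossings and hence links numbered from \<open>0\<close> to \<open>stops i y\<close>.\<close>

locale rect_warehouse =
  fixes W :: warehouse
  assumes rect: "rectangular_warehouse W"
begin

abbreviation path :: "nat \<Rightarrow> nat \<Rightarrow> node list" where
  "path i y \<equiv> subaisle_path W i y"

abbreviation stops :: "nat \<Rightarrow> nat \<Rightarrow> nat" where
  "stops i y \<equiv> length (locs W i y)"

lemma path_0: "path i y ! 0 = Crossing i y"
  by (simp add: subaisle_path_def)

lemma path_end: "path i y ! Suc (stops i y) = Crossing i (Suc y)"
  by (simp add: subaisle_path_def nth_append)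

lemma path_mid: "s < stops i y \<Longrightarrow> path i y ! Suc s = Stop (locs W i y ! s)"
  by (simp add: subaisle_path_def nth_append)

lemma length_path: "length (path i y) = stops i y + 2"
  by (simp add: subaisle_path_def)

lemma path_cases:
  assumes "s \<le> Suc (stops i y)"
  obtains "s = 0" "path i y ! s = Crossing i y"
  | r where "r < stops i y" "s = Suc r" "path i y ! s = Stop (locs W i y ! r)"
  | "s = Suc (stops i y)" "path i y ! s = Crossing i (Suc y)"
proof -
  consider "s = 0" | r where "s = Suc r" "r < stops i y" | "s = Suc (stops i y)"
    using assms by (metis Suc_leD Suc_le_mono le_less not0_implies_Suc)
  then show thesis
    using that path_0 path_end path_mid by cases auto
qed

lemma locs_subaisle:
  assumes "is_subaisle W i y"
  shows "distinct (locs W i y)"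
    and "set (locs W i y) = {t. t \<le> last_loc W \<and> site W t = In_Subaisle i y}"
    and "sorted (map (pos W) (locs W i y))"
  using rect assms by (auto simp: rectangular_warehouse_def)

lemma distinct_path: "is_subaisle W i y \<Longrightarrow> distinct (path i y)"
  by (auto simp: subaisle_path_def distinct_map inj_on_def locs_subaisle)

lemma path_neq:
  assumes "is_subaisle W i y" "s \<le> stops i y"
  shows "path i y ! s \<noteq> path i y ! Suc s"
  using distinct_path[OF assms(1)] assms(2)
  by (simp add: nth_eq_iff_index_eq length_path)

lemma path_node:
  assumes "is_subaisle W i y" "s \<le> Suc (stops i y)"
  shows "path i y ! s \<in> crossing_nodes W \<union> loc_nodes W"
  using assms(2)
proof (cases rule: path_cases)
  case (2 r)
  then have "locs W i y ! r \<in> set (locs W i y)" by simp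
  then have "site W (locs W i y ! r) = In_Subaisle i y" "locs W i y ! r \<le> last_loc W"
    using locs_subaisle(2)[OF assms(1)] by auto
  then show ?thesis using 2 unfolding loc_nodes_def
    by (intro UnI2 image_eqI[of _ _ "locs W i y ! r"]) auto
qed (use assms(1) in \<open>auto simp: crossing_nodes_def is_crossing_def is_subaisle_def\<close>)

lemma link_cases:
  assumes "l \<in> links W"
  obtains (H) i j where "l = HLink i j" "1 \<le> i" "i < aisles W" "1 \<le> j" "j \<le> cross_aisles W"
  | (V) i y s where "l = VLink i y s" "is_subaisle W i y" "s \<le> stops i y"
  using assms by (auto simp: links_def)

lemma HLink_in_links:
  "HLink i j \<in> links W \<longleftrightarrow> 1 \<le> i \<and> i < aisles W \<and> 1 \<le> j \<and> j \<le> cross_aisles W"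
  by (auto simp: links_def)

lemma VLink_in_links: "VLink i y s \<in> links W \<longleftrightarrow> is_subaisle W i y \<and> s \<le> stops i y"
  by (auto simp: links_def)

lemma finite_links: "finite (links W)"
proof -
  have "links W \<subseteq> (\<lambda>(i, j). HLink i j) ` ({..aisles W} \<times> {..cross_aisles W}) \<union>
      (\<Union>i\<le>aisles W. \<Union>y\<le>cross_aisles W. VLink i y ` {..stops i y})"
  proof
    fix l assume "l \<in> links W"
    then show "l \<in> (\<lambda>(i, j). HLink i j) ` ({..aisles W} \<times> {..cross_aisles W}) \<union>
      (\<Union>i\<le>aisles W. \<Union>y\<le>cross_aisles W. VLink i y ` {..stops i y})"
    proof (cases rule: link_cases)
      case (V i y s)
      then show ?thesis
        by (intro UnI2 UN_I[of i] UN_I[of y]) (auto simp: is_subaisle_def)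
    qed auto
  qed
  then show ?thesis by (rule finite_subset) auto
qed

lemma link_ends_nodes:
  assumes "l \<in> links W"
  shows "\<exists>x\<in>crossing_nodes W \<union> loc_nodes W. \<exists>y\<in>crossing_nodes W \<union> loc_nodes W.
           x \<noteq> y \<and> link_ends W l = {x, y}"
  using assms
proof (cases rule: link_cases)
  case (H i j)
  then show ?thesis
    by (intro bexI[of _ "Crossing i j"] bexI[of _ "Crossing (Suc i) j"])
      (auto simp: crossing_nodes_def is_crossing_def)
next
  case (V i y s)
  then show ?thesis
    using path_neq path_node[of i y s] path_node[of i y "Suc s"]
    by (intro bexI[of _ "path i y ! s"] bexI[of _ "path i y ! Suc s"]) auto
qed

text \<open>The nodes on a vertical link determine its subaisle: a stop through its site, and two
  crossings directly.\<close>

lemma VLink_end_cases: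
  assumes "is_subaisle W i y" "s \<le> stops i y" "x \<in> link_ends W (VLink i y s)"
  shows "(\<exists>t. x = Stop t \<and> site W t = In_Subaisle i y) \<or> x = Crossing i y \<or> x = Crossing i (Suc y)"
proof -
  have "x = path i y ! s \<or> x = path i y ! Suc s" using assms(3) by simp
  then obtain q where q: "q \<le> Suc (stops i y)" "x = path i y ! q"
    using assms(2) le_SucI Suc_le_mono by blast
  show ?thesis using q(1)
  proof (cases rule: path_cases)
    case (2 r)
    then have "locs W i y ! r \<in> set (locs W i y)" by simp
    then show ?thesis using 2 q locs_subaisle(2)[OF assms(1)] by auto
  qed (use q in auto)
qed

lemma VLink_ends_stop:
  assumes "s \<le> stops i y" "stops i y \<noteq> 0"
  shows "\<exists>t. Stop t \<in> link_ends W (VLink i y s)"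
  using path_mid[of 0 i y] path_mid[of "s - 1" i y] assms by (cases s) auto

lemma link_ends_inj: "inj_on (link_ends W) (links W)"
proof (rule inj_onI)
  fix l l' assume L: "l \<in> links W" "l' \<in> links W" and eq: "link_ends W l = link_ends W l'"
  have HV: "link_ends W (HLink a b) \<noteq> link_ends W (VLink i y s)"
    if "is_subaisle W i y" "s \<le> stops i y" for a b i y s
  proof
    assume "link_ends W (HLink a b) = link_ends W (VLink i y s)"
    then have "Crossing a b \<in> link_ends W (VLink i y s)" "Crossing (Suc a) b \<in> link_ends W (VLink i y s)"
      by auto
    then show False
      using VLink_end_cases[OF that, of "Crossing a b"] VLink_end_cases[OF that, of "Crossing (Suc a) b"]
      by auto
  qed
  show "l = l'"
    using L(1)
  proof (cases rule: link_cases)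
    case (H i j)
    show ?thesis using L(2)
    proof (cases rule: link_cases)
      case (H i' j')
      then show ?thesis using \<open>l = HLink i j\<close> eq by (auto simp: doubleton_eq_iff)
    next
      case (V i' y' s')
      then show ?thesis using HV[OF V(2,3), of i j] \<open>l = HLink i j\<close> eq by (simp only:)
    qed
  next
    case (V i y s)
    note V1 = V
    show ?thesis using L(2)
    proof (cases rule: link_cases)
      case (V i' y' s')
      have "i = i' \<and> y = y'"
      proof (cases "stops i y = 0 \<and> stops i' y' = 0")
        case True
        then have "link_ends W l = {Crossing i y, Crossing i (Suc y)}"
            "link_ends W l' = {Crossing i' y', Crossing i' (Suc y')}"
          using V V1 path_0 path_end[of i y] path_end[of i' y'] by auto
        then have "{Crossing i y, Crossing i (Suc y)} = {Crossing i' y', Crossing i' (Suc y')}"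
          using eq by (simp only:)
        then show ?thesis by (auto simp: doubleton_eq_iff)
      next
        case False
        then obtain t where "Stop t \<in> link_ends W l" "Stop t \<in> link_ends W l'"
          using VLink_ends_stop[OF V1(3)] VLink_ends_stop[OF V(3)] V(1) V1(1) eq by (simp only:) blast
        then have "site W t = In_Subaisle i y" "site W t = In_Subaisle i' y'"
          using VLink_end_cases[OF V1(2,3), of "Stop t"] VLink_end_cases[OF V(2,3), of "Stop t"]
            V(1) V1(1) by auto
        then show ?thesis by simp
      qed
      then have e: "i' = i" "y' = y" by auto
      have "{path i y ! s, path i y ! Suc s} = {path i y ! s', path i y ! Suc s'}"
        using eq V V1 e by simp
      then have "s = s'"
        using distinct_path[OF V1(2)] V V1 e
        by (auto simp: doubleton_eq_iff nth_eq_iff_index_eq length_path)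
      then show ?thesis using V V1 e by simp
    next
      case (H a b)
      then show ?thesis using HV[OF V1(2,3), of a b] V1(1) eq by (simp only:)
    qed
  qed
qed

lemma sorted_positions:
  assumes "is_subaisle W i y"
  shows "sorted (subaisle_positions W i y)"
proof -
  have "0 < pos W t \<and> pos W t < aisle_len W y" if "t \<in> set (locs W i y)" for t
  proof -
    have t: "t \<le> last_loc W" "site W t = In_Subaisle i y" using that locs_subaisle(2)[OF assms] by auto
    then have "in_subaisle W t"
      using rect by (cases "t = 0") (auto simp: rectangular_warehouse_def)
    then show ?thesis using t by (auto simp: in_subaisle_def)
  qed
  moreover have "0 < aisle_len W y"
    using rect assms by (auto simp: rectangular_warehouse_def is_subaisle_def)
  ultimately show ?thesis
    using locs_subaisle(3)[OF assms] by (force simp: subaisle_positions_def sorted_append)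
qed

lemma link_len_nonneg:
  assumes "l \<in> links W" shows "0 \<le> link_len W l"
  using assms
proof (cases rule: link_cases)
  case (H i j)
  then show ?thesis using rect by (auto simp: rectangular_warehouse_def intro: less_imp_le)
next
  case (V i y s)
  then show ?thesis
    using sorted_nth_mono[OF sorted_positions[OF V(2)], of s "Suc s"]
    by (simp add: subaisle_positions_def)
qed

lemma sum_link_len: "(\<Sum>s\<le>stops i y. link_len W (VLink i y s)) = aisle_len W y"
proof -
  have "(\<Sum>s\<le>stops i y. link_len W (VLink i y s)) =
      subaisle_positions W i y ! Suc (stops i y) - subaisle_positions W i y ! 0"
    using sum_lessThan_telescope[of "\<lambda>s. subaisle_positions W i y ! s" "Suc (stops i y)"]
    by (simp add: lessThan_Suc_atMost)
  then show ?thesis by (simp add: subaisle_positions_def nth_append)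
qed

section \<open>Link counts\<close>

text \<open>A subgraph is recorded, up to the choice between parallel edges and up to isolated
  vertices, by the number of edges that it uses on each link.\<close>

text \<open>The pairs of nodes joined by a used link, for link counts \<open>c\<close>.\<close>

definition joined :: "(link \<Rightarrow> nat) \<Rightarrow> (node \<times> node) set" where
  "joined c = {(x, y). \<exists>l\<in>links W. 0 < c l \<and> link_ends W l = {x, y}}"

text \<open>The nodes that the subgraph must contain: the locations and the ends of the used links.\<close>

definition used_nodes :: "(link \<Rightarrow> nat) \<Rightarrow> node set" where
  "used_nodes c = loc_nodes W \<union> \<Union> (link_ends W ` {l \<in> links W. 0 < c l})"

text \<open>Links have two distinct ends, so no link counts twice at a node.\<close>

definition degree :: "(link \<Rightarrow> nat) \<Rightarrow> node \<Rightarrow> nat" where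
  "degree c x = (\<Sum>l\<in>links W. c l * of_bool (x \<in> link_ends W l))"

text \<open>The link counts of tour subgraphs.\<close>

definition feasible :: "(link \<Rightarrow> nat) \<Rightarrow> bool" where
  "feasible c \<longleftrightarrow>
     (\<forall>l. c l \<le> 2) \<and> (\<forall>l. l \<notin> links W \<longrightarrow> c l = 0) \<and> (\<forall>x. even (degree c x)) \<and>
     (\<forall>x\<in>used_nodes c. \<forall>y\<in>used_nodes c. (x, y) \<in> (joined c)\<^sup>*)"

text \<open>The total length of a subgraph with the given link counts.\<close>

definition count_len :: "(link \<Rightarrow> nat) \<Rightarrow> real" where
  "count_len c = (\<Sum>l\<in>links W. real (c l) * link_len W l)"

text \<open>How many of the two parallel edges of a link are used.\<close>

definition link_count :: "(node, edge) mgraph \<Rightarrow> link \<Rightarrow> nat" where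
  "link_count T l = card {b. (l, b) \<in> edges T}"

text \<open>The subgraph with given link counts and no superfluous isolated vertices.\<close>

definition graph_of :: "(link \<Rightarrow> nat) \<Rightarrow> (node, edge) mgraph" where
  "graph_of c =
     \<lparr> verts = used_nodes c,
       edges = {(l, b). l \<in> links W \<and> (if b then c l = 2 else 0 < c l)},
       ends = (\<lambda>e. link_ends W (fst e)) \<rparr>"

lemma sum_edges:
  fixes f :: "link \<Rightarrow> 'a :: semiring_1"
  assumes "edges T \<subseteq> links W \<times> UNIV"
  shows "(\<Sum>e\<in>edges T. f (fst e)) = (\<Sum>l\<in>links W. of_nat (link_count T l) * f l)"
proof -
  have "edges T = (SIGMA l:links W. {b. (l, b) \<in> edges T})" using assms by auto
  then have "(\<Sum>e\<in>edges T. f (fst e)) = (\<Sum>e\<in>(SIGMA l:links W. {b. (l, b) \<in> edges T}). f (fst e))"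
    by simp
  also have "\<dots> = (\<Sum>l\<in>links W. \<Sum>b\<in>{b. (l, b) \<in> edges T}. f l)"
    using sum.Sigma[OF finite_links, of "\<lambda>l. {b. (l, b) \<in> edges T}" "\<lambda>l b. f l"]
    by (simp add: case_prod_unfold)
  finally show ?thesis by (simp add: link_count_def)
qed

lemma finite_edges: "edges T \<subseteq> links W \<times> UNIV \<Longrightarrow> finite (edges T)" for T :: "(node, edge) mgraph"
  by (rule finite_subset) (auto simp: finite_links)

lemma card_incident:
  assumes "edges T \<subseteq> links W \<times> UNIV" "ends T = (\<lambda>e. link_ends W (fst e))"
  shows "card {e \<in> edges T. x \<in> ends T e} = degree (link_count T) x"
proof -
  have "card {e \<in> edges T. x \<in> ends T e} = (\<Sum>e\<in>edges T. of_bool (x \<in> link_ends W (fst e)))"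
    using finite_edges[OF assms(1)] assms(2) by (simp add: Int_def)
  then show ?thesis
    using sum_edges[OF assms(1), of "\<lambda>l. of_bool (x \<in> link_ends W l) :: nat"] by (simp add: degree_def)
qed

lemma link_count_pos: "0 < link_count T l \<longleftrightarrow> (\<exists>b. (l, b) \<in> edges T)"
  by (simp add: link_count_def card_gt_0_iff)

lemma mult_link:
  assumes "edges T \<subseteq> links W \<times> UNIV" "ends T = (\<lambda>e. link_ends W (fst e))"
    and "l \<in> links W" "link_ends W l = {x, y}"
  shows "mult T x y = link_count T l"
proof -
  have "(l', b) \<in> edges T \<and> link_ends W l' = {x, y} \<longleftrightarrow> l' = l \<and> (l, b) \<in> edges T" for l' b
    using assms inj_onD[OF link_ends_inj, of l' l] by auto
  then have "e \<in> {e \<in> edges T. ends T e = {x, y}} \<longleftrightarrow> e \<in> Pair l ` {b. (l, b) \<in> edges T}" for e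
    by (cases e) (simp add: assms(2) image_iff; blast)
  then have "{e \<in> edges T. ends T e = {x, y}} = Pair l ` {b. (l, b) \<in> edges T}"
    by blast
  then show ?thesis by (simp add: mult_def link_count_def card_image inj_on_def)
qed

lemma tour_subgraphD:
  assumes "tour_subgraph W T"
  shows "edges T \<subseteq> links W \<times> UNIV" "ends T = (\<lambda>e. link_ends W (fst e))" "loop_free T"
    "loc_nodes W \<subseteq> verts T"
proof -
  show E: "edges T \<subseteq> links W \<times> UNIV" "ends T = (\<lambda>e. link_ends W (fst e))" "loc_nodes W \<subseteq> verts T"
    using assms by (auto simp: tour_subgraph_def subgraph_def warehouse_graph_def)
  show "loop_free T" unfolding loop_free_def
  proof
    fix e assume e: "e \<in> edges T"
    then have "fst e \<in> links W" using E by auto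
    then obtain x y where "x \<noteq> y" "link_ends W (fst e) = {x, y}" using link_ends_nodes by blast
    moreover have "ends T e \<subseteq> verts T" using assms e unfolding tour_subgraph_def subgraph_def by blast
    ultimately show "\<exists>x\<in>verts T. \<exists>y\<in>verts T. x \<noteq> y \<and> ends T e = {x, y}" using E by auto
  qed
qed

lemma total_len_link_count:
  assumes "edges T \<subseteq> links W \<times> UNIV"
  shows "total_len W T = count_len (link_count T)"
  using sum_edges[OF assms, of "link_len W"] by (simp add: total_len_def count_len_def)

lemma feasible_link_count:
  assumes T: "tour_subgraph W T"
  shows "feasible (link_count T)"
proof -
  note D = tour_subgraphD[OF T]
  obtain vs es where tour: "tour T vs es" using T by (auto simp: tour_subgraph_def)
  have "link_count T l \<le> 2" for l
    using card_mono[of "UNIV :: bool set" "{b. (l, b) \<in> edges T}"] by (simp add: link_count_def)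
  moreover have "link_count T l = 0" if "l \<notin> links W" for l
    using that D(1) link_count_pos[of T l] by auto
  moreover have "even (degree (link_count T) x)" for x
    using tour_even_degree[OF tour D(3)] card_incident[OF D(1,2)] by simp
  moreover have "(x, y) \<in> (joined (link_count T))\<^sup>*"
    if "x \<in> used_nodes (link_count T)" "y \<in> used_nodes (link_count T)" for x y
  proof -
    have "used_nodes (link_count T) \<subseteq> verts T"
    proof -
      have "link_ends W l \<subseteq> verts T" if l: "0 < link_count T l" for l
      proof -
        obtain b where "(l, b) \<in> edges T" using l link_count_pos by blast
        then have "ends T (l, b) \<subseteq> verts T" using T unfolding tour_subgraph_def subgraph_def by blast
        then show ?thesis using D(2) by simp
      qed
      then show ?thesis using D(4) by (auto simp: used_nodes_def)
    qed
    then have "(x, y) \<in> (adj T)\<^sup>*" using that tour_connected[OF tour] by auto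
    moreover have "adj T \<subseteq> joined (link_count T)"
    proof clarify
      fix u v assume "(u, v) \<in> adj T"
      then obtain l b where lb: "(l, b) \<in> edges T" "link_ends W l = {u, v}"
        using D(2) by (auto simp: adj_def)
      then have "l \<in> links W" using D(1) by auto
      then show "(u, v) \<in> joined (link_count T)"
        using lb link_count_pos[of T l] by (auto simp: joined_def)
    qed
    ultimately show ?thesis using rtrancl_mono by blast
  qed
  ultimately show ?thesis by (auto simp: feasible_def)
qed

lemma graph_of_edges: "edges (graph_of c) \<subseteq> links W \<times> UNIV"
  "ends (graph_of c) = (\<lambda>e. link_ends W (fst e))"
  by (auto simp: graph_of_def)

lemma link_count_graph_of:
  assumes "feasible c" shows "link_count (graph_of c) = c"
proof
  fix l
  have c: "c l \<le> 2" "l \<notin> links W \<Longrightarrow> c l = 0" using assms by (auto simp: feasible_def)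
  have "{b. (l, b) \<in> edges (graph_of c)} =
      (if c l = 0 then {} else if c l = 1 then {False} else {False, True})"
    using c by (auto simp: graph_of_def split: if_splits)
  then show "link_count (graph_of c) l = c l" using c by (auto simp: link_count_def)
qed

lemma loc_nodes_nonempty: "loc_nodes W \<noteq> {}"
  by (auto simp: loc_nodes_def)

lemma used_nodes_sub: "used_nodes c \<subseteq> crossing_nodes W \<union> loc_nodes W"
proof -
  have "link_ends W l \<subseteq> crossing_nodes W \<union> loc_nodes W" if "l \<in> links W" for l
    using link_ends_nodes[OF that] by auto
  then show ?thesis by (auto simp: used_nodes_def)
qed

lemma tour_subgraph_graph_of:
  assumes c: "feasible c"
  shows "tour_subgraph W (graph_of c)"
proof -
  let ?T = "graph_of c"
  have ends: "link_ends W l \<subseteq> used_nodes c" if "l \<in> links W" "0 < c l" for l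
    using that by (auto simp: used_nodes_def)
  have edge: "fst e \<in> links W \<and> 0 < c (fst e)" if "e \<in> edges ?T" for e
    using that by (auto simp: graph_of_def split: if_splits)
  have sub: "subgraph ?T (warehouse_graph W)"
    unfolding subgraph_def
  proof (intro conjI ballI)
    show "ends ?T e \<subseteq> verts ?T" if "e \<in> edges ?T" for e
      using ends[of "fst e"] edge[OF that] by (simp add: graph_of_def)
  qed (use used_nodes_sub[of c] in \<open>auto simp: warehouse_graph_def graph_of_def\<close>)
  have lf: "loop_free ?T" unfolding loop_free_def
  proof
    fix e assume e: "e \<in> edges ?T"
    obtain x y where "x \<noteq> y" "link_ends W (fst e) = {x, y}"
      using link_ends_nodes edge[OF e] by blast
    then show "\<exists>x\<in>verts ?T. \<exists>y\<in>verts ?T. x \<noteq> y \<and> ends ?T e = {x, y}"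
      using ends[of "fst e"] edge[OF e] by (auto simp: graph_of_def)
  qed
  have "joined c \<subseteq> adj ?T"
  proof clarify
    fix x y assume "(x, y) \<in> joined c"
    then obtain l where "l \<in> links W" "0 < c l" "link_ends W l = {x, y}" by (auto simp: joined_def)
    then have "(l, False) \<in> edges ?T" "ends ?T (l, False) = {x, y}" by (auto simp: graph_of_def)
    then show "(x, y) \<in> adj ?T" unfolding adj_def by blast
  qed
  have con: "(x, y) \<in> (adj ?T)\<^sup>*" if "x \<in> verts ?T" "y \<in> verts ?T" for x y
  proof -
    have "(x, y) \<in> (joined c)\<^sup>*" using that c by (simp add: feasible_def graph_of_def)
    then show ?thesis using rtrancl_mono[OF \<open>joined c \<subseteq> adj ?T\<close>] by blast
  qed
  have "\<exists>vs es. tour ?T vs es"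
  proof (rule euler_tour[OF _ lf])
    show "finite (edges ?T)" by (rule finite_edges[OF graph_of_edges(1)])
    show "even (card {e \<in> edges ?T. v \<in> ends ?T e})" for v
      using card_incident[OF graph_of_edges] link_count_graph_of[OF c] c by (simp add: feasible_def)
    show "verts ?T \<noteq> {}" using loc_nodes_nonempty by (auto simp: graph_of_def used_nodes_def)
  qed (rule con)
  then show ?thesis using sub by (auto simp: tour_subgraph_def graph_of_def used_nodes_def)
qed

lemma minimum_graph_of:
  assumes "feasible c" "\<And>c'. feasible c' \<Longrightarrow> count_len c \<le> count_len c'"
  shows "minimum_tour_subgraph W (graph_of c)"
  unfolding minimum_tour_subgraph_def
proof (intro conjI allI impI)
  show "tour_subgraph W (graph_of c)" using assms(1) by (rule tour_subgraph_graph_of)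
  fix T assume "tour_subgraph W T"
  then show "total_len W (graph_of c) \<le> total_len W T"
    using assms total_len_link_count graph_of_edges(1) tour_subgraphD(1) feasible_link_count
    by (simp add: link_count_graph_of)
qed

lemma finite_feasible: "finite {c. feasible c}"
proof (rule finite_subset)
  show "{c. feasible c} \<subseteq> {c. \<forall>l. (l \<in> links W \<longrightarrow> c l \<in> {..2}) \<and> (l \<notin> links W \<longrightarrow> c l = 0)}"
    by (auto simp: feasible_def)
  show "finite {c. \<forall>l. (l \<in> links W \<longrightarrow> c l \<in> {..2}) \<and> (l \<notin> links W \<longrightarrow> c l = (0::nat))}"
    by (intro finite_set_of_finite_funs finite_links finite_atMost)
qed

section \<open>Connectivity and parity\<close>

lemma joined_sym: "(x, y) \<in> (joined c)\<^sup>* \<Longrightarrow> (y, x) \<in> (joined c)\<^sup>*"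
proof -
  have "sym (joined c)" by (auto simp: joined_def sym_def insert_commute)
  then show "(x, y) \<in> (joined c)\<^sup>* \<Longrightarrow> (y, x) \<in> (joined c)\<^sup>*" by (metis sym_rtrancl symD)
qed

lemma joined_link: "l \<in> links W \<Longrightarrow> 0 < c l \<Longrightarrow> link_ends W l = {x, y} \<Longrightarrow> (x, y) \<in> joined c"
  by (auto simp: joined_def)

lemma path_joined:
  assumes "is_subaisle W i y" "s \<le> s'" "s' \<le> Suc (stops i y)"
    and "\<And>q. s \<le> q \<Longrightarrow> q < s' \<Longrightarrow> 0 < c (VLink i y q)"
  shows "(path i y ! s, path i y ! s') \<in> (joined c)\<^sup>*"
  using assms(2-)
proof (induction s' rule: dec_induct)
  case (step q)
  then have "(path i y ! q, path i y ! Suc q) \<in> joined c"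
    by (intro joined_link[of "VLink i y q"]) (auto simp: VLink_in_links assms(1))
  then show ?case using step by (auto intro: rtrancl_into_rtrancl)
qed auto

lemma aisle_joined:
  assumes "1 \<le> i" "i \<le> aisles W" "1 \<le> j" "j \<le> k" "k \<le> cross_aisles W"
    and "\<And>y s. j \<le> y \<Longrightarrow> y < k \<Longrightarrow> s \<le> stops i y \<Longrightarrow> 0 < c (VLink i y s)"
  shows "(Crossing i j, Crossing i k) \<in> (joined c)\<^sup>*"
  using assms(4-)
proof (induction k rule: dec_induct)
  case (step y)
  have "(Crossing i y, Crossing i (Suc y)) \<in> (joined c)\<^sup>*"
    using path_joined[of i y 0 "Suc (stops i y)" c] step assms(1-3)
    by (auto simp: path_0 path_end is_subaisle_def)
  then show ?case using step by (auto intro: rtrancl_trans)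
qed auto

text \<open>A depot at a crossing contributes no node of its own.\<close>

lemma node_cases:
  assumes "x \<in> crossing_nodes W \<union> loc_nodes W"
  obtains (C) i j where "x = Crossing i j" "is_crossing W i j"
  | (S) i y r where "x = path i y ! Suc r" "is_subaisle W i y" "r < stops i y"
proof (cases "x \<in> crossing_nodes W")
  case True
  then show ?thesis using C by (auto simp: crossing_nodes_def)
next
  case False
  then obtain t where t: "t \<le> last_loc W" "x = site_node (site W t) t"
    using assms by (auto simp: loc_nodes_def)
  have "(\<exists>i j. is_crossing W i j \<and> site W t = At_Crossing i j) \<or> in_subaisle W t"
    using rect t(1) by (cases "t = 0") (auto simp: rectangular_warehouse_def)
  then consider i j where "is_crossing W i j" "site W t = At_Crossing i j"
    | i y where "is_subaisle W i y" "site W t = In_Subaisle i y"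
    by (auto simp: in_subaisle_def)
  then show ?thesis
  proof cases
    case 1
    then show ?thesis using C t by auto
  next
    case (2 i y)
    then have "t \<in> set (locs W i y)" using locs_subaisle(2) t by auto
    then obtain r where "r < stops i y" "locs W i y ! r = t" by (auto simp: in_set_conv_nth)
    then show ?thesis using S[of i y r] 2 t path_mid by auto
  qed
qed

lemma feasible_all: "feasible (\<lambda>l. if l \<in> links W then 2 else 0)" (is "feasible ?c")
proof -
  have row: "(Crossing 1 1, Crossing i 1) \<in> (joined ?c)\<^sup>*" if "1 \<le> i" "i \<le> aisles W" for i
    using that
  proof (induction i rule: dec_induct)
    case (step i)
    then have "(Crossing i 1, Crossing (Suc i) 1) \<in> joined ?c"
      using rect by (intro joined_link[of "HLink i 1"])
        (auto simp: HLink_in_links rectangular_warehouse_def)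
    then show ?case using step by (auto intro: rtrancl_into_rtrancl)
  qed auto
  have col: "(Crossing 1 1, Crossing i j) \<in> (joined ?c)\<^sup>*" if "is_crossing W i j" for i j
  proof -
    have "(Crossing i 1, Crossing i j) \<in> (joined ?c)\<^sup>*"
      using that by (intro aisle_joined) (auto simp: is_crossing_def VLink_in_links is_subaisle_def)
    then show ?thesis using row[of i] that by (auto simp: is_crossing_def)
  qed
  have "(Crossing 1 1, x) \<in> (joined ?c)\<^sup>*" if "x \<in> used_nodes ?c" for x
  proof -
    have "x \<in> crossing_nodes W \<union> loc_nodes W" using that used_nodes_sub by blast
    then show ?thesis
    proof (cases rule: node_cases)
      case (S i y r)
      then have "(Crossing i y, x) \<in> (joined ?c)\<^sup>*"
        using path_joined[of i y 0 "Suc r" ?c] by (auto simp: path_0 VLink_in_links)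
      moreover have "is_crossing W i y" using S by (auto simp: is_crossing_def is_subaisle_def)
      ultimately show ?thesis using col by (meson rtrancl_trans)
    qed (use col in auto)
  qed
  then have "\<forall>x\<in>used_nodes ?c. \<forall>y\<in>used_nodes ?c. (x, y) \<in> (joined ?c)\<^sup>*"
    using joined_sym by (meson rtrancl_trans)
  moreover have "even (degree ?c x)" for x
    unfolding degree_def by (rule dvd_sum) auto
  ultimately show ?thesis by (auto simp: feasible_def)
qed

text \<open>Connectedness carries over to other link counts if the ends of every abandoned link
  are joined by other links, and every new node is joined to an old one.\<close>

lemma connected_transfer:
  assumes c: "feasible c"
    and step: "\<And>l x y. l \<in> links W \<Longrightarrow> 0 < c l \<Longrightarrow> c' l = 0 \<Longrightarrow> link_ends W l = {x, y} \<Longrightarrow>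
      (x, y) \<in> (joined c')\<^sup>*"
    and new: "\<And>x. x \<in> used_nodes c' \<Longrightarrow> \<exists>y\<in>used_nodes c. (x, y) \<in> (joined c')\<^sup>*"
  shows "\<forall>x\<in>used_nodes c'. \<forall>y\<in>used_nodes c'. (x, y) \<in> (joined c')\<^sup>*"
proof (intro ballI)
  fix x y assume "x \<in> used_nodes c'" "y \<in> used_nodes c'"
  then obtain u v where u: "u \<in> used_nodes c" "(x, u) \<in> (joined c')\<^sup>*"
    and v: "v \<in> used_nodes c" "(y, v) \<in> (joined c')\<^sup>*" using new by metis
  have "joined c \<subseteq> (joined c')\<^sup>*"
  proof clarify
    fix a b assume "(a, b) \<in> joined c"
    then obtain l where l: "l \<in> links W" "0 < c l" "link_ends W l = {a, b}" by (auto simp: joined_def)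
    then show "(a, b) \<in> (joined c')\<^sup>*"
      using step[of l a b] joined_link[of l c' a b] by (cases "c' l = 0") auto
  qed
  then have "(u, v) \<in> (joined c')\<^sup>*"
    using c u v rtrancl_subset_rtrancl[of "joined c" "joined c'"] unfolding feasible_def by blast
  then show "(x, y) \<in> (joined c')\<^sup>*"
    using u v joined_sym by (meson rtrancl_trans)
qed

text \<open>Parities of degrees survive if the links whose count changes parity form a set \<open>R\<close> that
  meets every node evenly.\<close>

lemma even_degree_change:
  assumes "even (degree c x)"
    and "\<And>l. l \<in> links W \<Longrightarrow> odd (c l + c' l) \<longleftrightarrow> l \<in> R"
    and "even (\<Sum>l\<in>links W. of_bool (l \<in> R) * of_bool (x \<in> link_ends W l) :: nat)"
  shows "even (degree c' x)"
proof -
  have *: "even (sum f L) = even (sum g L)" if "\<And>l. l \<in> L \<Longrightarrow> even (f l) = even (g l)" "finite L"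
    for f g :: "link \<Rightarrow> nat" and L
    using that(2,1) by (induction L) auto
  have "even (degree c x + degree c' x) \<longleftrightarrow>
      even (\<Sum>l\<in>links W. of_bool (l \<in> R) * of_bool (x \<in> link_ends W l) :: nat)"
    unfolding degree_def sum.distrib[symmetric]
  proof (rule *)
    fix l assume "l \<in> links W"
    then show "even (c l * of_bool (x \<in> link_ends W l) + c' l * of_bool (x \<in> link_ends W l)) =
        even (of_bool (l \<in> R) * of_bool (x \<in> link_ends W l) :: nat)"
      using assms(2)[of l] by auto
  qed (rule finite_links)
  then show ?thesis using assms by auto
qed

section \<open>Rectangles\<close>

text \<open>Neighbouring aisles \<open>i\<close>, \<open>i'\<close> and distinct cross-aisles \<open>e\<close>, \<open>f\<close>. Neither pair is ordered:
  a rectangle is flipped from aisle \<open>i\<close> to aisle \<open>i'\<close>, and from cross-aisle \<open>e\<close> to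
  cross-aisle \<open>f\<close>.\<close>

definition is_rect :: "nat \<Rightarrow> nat \<Rightarrow> nat \<Rightarrow> nat \<Rightarrow> bool" where
  "is_rect i i' e f \<longleftrightarrow>
     (i' = Suc i \<or> i = Suc i') \<and> 1 \<le> i \<and> i \<le> aisles W \<and> 1 \<le> i' \<and> i' \<le> aisles W \<and>
     1 \<le> e \<and> e \<le> cross_aisles W \<and> 1 \<le> f \<and> f \<le> cross_aisles W \<and> e \<noteq> f"

text \<open>The boundary of the rectangle. The horizontal links between the two aisles carry the
  smaller aisle number.\<close>

definition rect_links :: "nat \<Rightarrow> nat \<Rightarrow> nat \<Rightarrow> nat \<Rightarrow> link set" where
  "rect_links i i' e f =
     {HLink (min i i') e, HLink (min i i') f} \<union>
     {VLink b y s | b y s. (b = i \<or> b = i') \<and> min e f \<le> y \<and> y < max e f \<and> s \<le> stops b y}"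

lemma HLink_in_rect: "HLink b y \<in> rect_links i i' e f \<longleftrightarrow> b = min i i' \<and> (y = e \<or> y = f)"
  by (auto simp: rect_links_def)

lemma VLink_in_rect:
  "VLink b y s \<in> rect_links i i' e f \<longleftrightarrow>
     (b = i \<or> b = i') \<and> min e f \<le> y \<and> y < max e f \<and> s \<le> stops b y"
  by (auto simp: rect_links_def)

lemma rect_links_sub: "is_rect i i' e f \<Longrightarrow> rect_links i i' e f \<subseteq> links W"
  by (auto simp: rect_links_def is_rect_def HLink_in_links VLink_in_links is_subaisle_def)

lemma sum_rect:
  fixes F :: "link \<Rightarrow> 'a :: comm_monoid_add"
  assumes r: "is_rect i i' e f"
    and z: "\<And>l. l \<in> links W \<Longrightarrow> l \<notin> rect_links i i' e f \<Longrightarrow> F l = 0"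
  shows "sum F (links W) = F (HLink (min i i') e) + F (HLink (min i i') f) +
    (\<Sum>y\<in>{min e f..<max e f}. \<Sum>s\<le>stops i y. F (VLink i y s)) +
    (\<Sum>y\<in>{min e f..<max e f}. \<Sum>s\<le>stops i' y. F (VLink i' y s))"
proof -
  define V where "V b = (\<Union>y\<in>{min e f..<max e f}. VLink b y ` {..stops b y})" for b
  have V: "sum F (V b) = (\<Sum>y\<in>{min e f..<max e f}. \<Sum>s\<le>stops b y. F (VLink b y s))" for b
  proof -
    have "sum F (V b) = (\<Sum>y\<in>{min e f..<max e f}. sum F (VLink b y ` {..stops b y}))"
      unfolding V_def by (rule sum.UNION_disjoint) auto
    then show ?thesis by (simp add: sum.reindex inj_on_def)
  qed
  have R: "rect_links i i' e f = {HLink (min i i') e, HLink (min i i') f} \<union> V i \<union> V i'"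
    by (auto simp: rect_links_def V_def)
  have fin: "finite (V b)" for b by (simp add: V_def)
  have ne: "i \<noteq> i'" "e \<noteq> f" using r by (auto simp: is_rect_def)
  have "sum F (links W) = sum F (rect_links i i' e f)"
    using rect_links_sub[OF r] z by (intro sum.mono_neutral_right finite_links) auto
  also have "\<dots> = sum F ({HLink (min i i') e, HLink (min i i') f} \<union> V i) + sum F (V i')"
    unfolding R using ne by (intro sum.union_disjoint) (auto simp: fin V_def)
  also have "sum F ({HLink (min i i') e, HLink (min i i') f} \<union> V i) =
      sum F {HLink (min i i') e, HLink (min i i') f} + sum F (V i)"
    by (intro sum.union_disjoint) (auto simp: fin V_def)
  finally show ?thesis using ne by (simp add: V)
qed

lemma even_subaisle:
  assumes "is_subaisle W i y"
  shows "even (\<Sum>s\<le>stops i y. of_bool (x \<in> link_ends W (VLink i y s)) :: nat) \<longleftrightarrow>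
    even (of_bool (x = Crossing i y) + of_bool (x = Crossing i (Suc y)) :: nat)"
proof -
  have "(\<Sum>s\<le>stops i y. of_bool (x \<in> link_ends W (VLink i y s)) :: nat) =
      (\<Sum>s<Suc (stops i y). of_bool (x = path i y ! s) + of_bool (x = path i y ! Suc s))"
    unfolding lessThan_Suc_atMost using path_neq[OF assms] by (intro sum.cong) force+
  then show ?thesis
    using even_sum_consecutive[of "\<lambda>s. of_bool (x = path i y ! s)" "Suc (stops i y)"]
    by (simp add: path_0 path_end)
qed

lemma even_aisle:
  assumes "1 \<le> i" "i \<le> aisles W" "1 \<le> j" "j \<le> k" "k \<le> cross_aisles W"
  shows "even (\<Sum>y\<in>{j..<k}. \<Sum>s\<le>stops i y. of_bool (x \<in> link_ends W (VLink i y s)) :: nat) \<longleftrightarrow>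
    even (of_bool (x = Crossing i j) + of_bool (x = Crossing i k) :: nat)"
  using assms(4,5)
proof (induction k rule: dec_induct)
  case (step y)
  then have "is_subaisle W i y" using assms(1-3) by (auto simp: is_subaisle_def)
  from even_subaisle[OF this, of x] step show ?case by auto
qed auto

lemma even_rect:
  assumes r: "is_rect i i' e f"
  shows "even (\<Sum>l\<in>links W. of_bool (l \<in> rect_links i i' e f) * of_bool (x \<in> link_ends W l) :: nat)"
proof -
  let ?F = "\<lambda>l. of_bool (l \<in> rect_links i i' e f) * of_bool (x \<in> link_ends W l) :: nat"
  have V: "(\<Sum>y\<in>{min e f..<max e f}. \<Sum>s\<le>stops b y. ?F (VLink b y s)) =
      (\<Sum>y\<in>{min e f..<max e f}. \<Sum>s\<le>stops b y. of_bool (x \<in> link_ends W (VLink b y s)))"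
    if "b = i \<or> b = i'" for b
    using that by (intro sum.cong) (auto simp: VLink_in_rect)
  have E: "even (\<Sum>y\<in>{min e f..<max e f}. \<Sum>s\<le>stops b y. ?F (VLink b y s)) \<longleftrightarrow>
      even (of_bool (x = Crossing b (min e f)) + of_bool (x = Crossing b (max e f)) :: nat)"
    if "b = i \<or> b = i'" for b
    unfolding V[OF that] using r that by (intro even_aisle) (auto simp: is_rect_def)
  have H: "?F (HLink (min i i') y) = of_bool (x = Crossing i y) + of_bool (x = Crossing i' y)"
    if "y = e \<or> y = f" for y
    using that r by (auto simp: HLink_in_rect is_rect_def)
  have "sum ?F (links W) = ?F (HLink (min i i') e) + ?F (HLink (min i i') f) +
    (\<Sum>y\<in>{min e f..<max e f}. \<Sum>s\<le>stops i y. ?F (VLink i y s)) +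
    (\<Sum>y\<in>{min e f..<max e f}. \<Sum>s\<le>stops i' y. ?F (VLink i' y s))"
    by (rule sum_rect[OF r]) auto
  then show ?thesis using H[of e] H[of f] E[of i] E[of i']
    by (cases "e \<le> f") (auto simp: min_def max_def simp del: link_ends.simps)
qed

section \<open>Flipping a rectangle\<close>

text \<open>One more edge on a link; three parallel edges, which do not exist, are replaced by one,
  which has the same parity and keeps the link used.\<close>

definition bump :: "nat \<Rightarrow> nat" where
  "bump n = (if n = 2 then 1 else Suc n)"

text \<open>Along the boundary of the rectangle, one edge is removed on cross-aisle \<open>e\<close>, one is added on
  cross-aisle \<open>f\<close> and to every link of aisle \<open>i'\<close>, and aisle \<open>i\<close>, which is double when the flip is
  applied, becomes single.\<close>

fun flip :: "(link \<Rightarrow> nat) \<Rightarrow> nat \<Rightarrow> nat \<Rightarrow> nat \<Rightarrow> nat \<Rightarrow> link \<Rightarrow> nat" where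
  "flip c i i' e f (HLink b y) =
     (if b = min i i' \<and> y = e then c (HLink b y) - 1
      else if b = min i i' \<and> y = f then bump (c (HLink b y))
      else c (HLink b y))"
| "flip c i i' e f (VLink b y s) =
     (if (b = i \<or> b = i') \<and> min e f \<le> y \<and> y < max e f \<and> s \<le> stops b y
      then if b = i then 1 else bump (c (VLink b y s))
      else c (VLink b y s))"

text \<open>The subaisles of aisle \<open>i\<close> that are completely doubled.\<close>

definition doubled :: "(link \<Rightarrow> nat) \<Rightarrow> nat \<Rightarrow> nat set" where
  "doubled c i = {y. is_subaisle W i y \<and> (\<forall>s\<le>stops i y. c (VLink i y s) = 2)}"

text \<open>The weights decrease by 1 from each aisle to the next, so that moving doubled subaisles to
  the right lowers the potential. They are at least the number of cross-aisles, so that losing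
  one doubled subaisle outweighs moving all others of the same flip to the left.\<close>

definition potential :: "(link \<Rightarrow> nat) \<Rightarrow> nat" where
  "potential c = (\<Sum>i\<in>{1..aisles W}. (cross_aisles W + aisles W - i) * card (doubled c i))"

lemma finite_doubled: "finite (doubled c i)"
  by (rule finite_subset[of _ "{..cross_aisles W}"]) (auto simp: doubled_def is_subaisle_def)

context
  fixes c :: "link \<Rightarrow> nat" and i i' e f :: nat
  assumes feas: "feasible c"
    and rct: "is_rect i i' e f"
    and dbl: "\<And>y s. min e f \<le> y \<Longrightarrow> y < max e f \<Longrightarrow> s \<le> stops i y \<Longrightarrow> c (VLink i y s) = 2"
    and hor: "0 < c (HLink (min i i') e)"
begin

lemma count_le_2: "c l \<le> 2"
  using feas by (simp add: feasible_def)

lemma flip_outside: "l \<notin> rect_links i i' e f \<Longrightarrow> flip c i i' e f l = c l"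
  by (cases l) (auto simp: HLink_in_rect VLink_in_rect)

lemma flip_le_2: "flip c i i' e f l \<le> 2"
proof -
  have "bump n \<le> 2" "n - 1 \<le> 2" if "n \<le> 2" for n using that by (auto simp: bump_def)
  then show ?thesis using count_le_2 by (cases l) auto
qed

lemma odd_flip: "odd (c l + flip c i i' e f l) \<longleftrightarrow> l \<in> rect_links i i' e f"
proof (cases "l \<in> rect_links i i' e f")
  case True
  have bump: "odd (n + bump n)" for n by (auto simp: bump_def)
  have dec: "odd (n + (n - 1))" if "0 < n" for n :: nat using that by (cases n) auto
  have "odd (c l + flip c i i' e f l)"
  proof (cases l)
    case (HLink b y)
    then show ?thesis using True bump[of "c l"] dec[OF hor] by (auto simp: HLink_in_rect)
  next
    case (VLink b y s)
    then show ?thesis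
      using True bump[of "c l"] dbl[of y s] by (auto simp: VLink_in_rect)
  qed
  then show ?thesis using True by simp
qed (simp add: flip_outside)

lemma flip_pos:
  assumes "0 < c l \<or> l \<in> rect_links i i' e f" "l \<noteq> HLink (min i i') e"
  shows "0 < flip c i i' e f l"
  using assms rct by (cases l) (auto simp: HLink_in_rect VLink_in_rect is_rect_def bump_def)

lemma flip_aisle_joined:
  assumes "b = i \<or> b = i'" "min e f \<le> j" "j \<le> k" "k \<le> max e f"
  shows "(Crossing b j, Crossing b k) \<in> (joined (flip c i i' e f))\<^sup>*"
proof (rule aisle_joined)
  fix y s assume "j \<le> y" "y < k" "s \<le> stops b y"
  then have "VLink b y s \<in> rect_links i i' e f" using assms by (auto simp: VLink_in_rect)
  then show "0 < flip c i i' e f (VLink b y s)" by (intro flip_pos) auto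
qed (use assms rct in \<open>auto simp: is_rect_def\<close>)

text \<open>All nodes on the boundary are joined to the corner \<open>Crossing i f\<close>, without the link on
  cross-aisle \<open>e\<close>, which may have become unused.\<close>

lemma flip_corners:
  assumes "b = i \<or> b = i'" "y = e \<or> y = f"
  shows "(Crossing b y, Crossing i f) \<in> (joined (flip c i i' e f))\<^sup>*"
proof -
  let ?J = "joined (flip c i i' e f)"
  have A: "(Crossing b e, Crossing b f) \<in> ?J\<^sup>*" if "b = i \<or> b = i'" for b
    using flip_aisle_joined[OF that, of "min e f" "max e f"] joined_sym
    by (cases "e \<le> f") (auto simp: min_def max_def)
  have "HLink (min i i') f \<in> rect_links i i' e f" by (auto simp: HLink_in_rect)
  moreover from this have "0 < flip c i i' e f (HLink (min i i') f)"
    using rct by (intro flip_pos) (auto simp: is_rect_def)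
  ultimately have "(Crossing i' f, Crossing i f) \<in> ?J"
    using rct rect_links_sub[OF rct]
    by (intro joined_link[of "HLink (min i i') f"]) (auto simp: is_rect_def)
  then show ?thesis using A assms by (blast intro: rtrancl_trans)
qed

lemma flip_rect_node:
  assumes "l \<in> rect_links i i' e f" "x \<in> link_ends W l"
  shows "(x, Crossing i f) \<in> (joined (flip c i i' e f))\<^sup>*"
proof (cases l)
  case (HLink b y)
  then have "b = min i i'" "y = e \<or> y = f" using assms by (auto simp: HLink_in_rect)
  then show ?thesis using assms rct flip_corners HLink by (auto simp: is_rect_def min_def)
next
  case (VLink b y s)
  then have b: "b = i \<or> b = i'" "min e f \<le> y" "y < max e f" "s \<le> stops b y"
    using assms by (auto simp: VLink_in_rect)
  then have sub: "is_subaisle W b y" using rct by (auto simp: is_rect_def is_subaisle_def)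
  have "x = path b y ! s \<or> x = path b y ! Suc s" using assms VLink by simp
  then obtain q where q: "q \<le> Suc (stops b y)" "x = path b y ! q"
    using b(4) le_SucI Suc_le_mono by blast
  have "(path b y ! 0, path b y ! q) \<in> (joined (flip c i i' e f))\<^sup>*"
    using sub q(1) b by (intro path_joined flip_pos) (auto simp: VLink_in_rect)
  then have "(x, Crossing b y) \<in> (joined (flip c i i' e f))\<^sup>*"
    using q(2) joined_sym by (simp add: path_0)
  also have "(Crossing b y, Crossing b (max e f)) \<in> (joined (flip c i i' e f))\<^sup>*"
    using b by (intro flip_aisle_joined) auto
  also have "(Crossing b (max e f), Crossing i f) \<in> (joined (flip c i i' e f))\<^sup>*"
    using b by (intro flip_corners) (auto simp: max_def)
  finally show ?thesis .
qed

lemma feasible_flip: "feasible (flip c i i' e f)"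
proof -
  let ?c = "flip c i i' e f"
  have supp: "?c l = 0" if "l \<notin> links W" for l
    using that flip_outside[of l] rect_links_sub[OF rct] feas by (auto simp: feasible_def)
  have "even (degree ?c x)" for x
    using feas by (intro even_degree_change[OF _ odd_flip even_rect[OF rct]]) (simp add: feasible_def)
  moreover have "\<forall>x\<in>used_nodes ?c. \<forall>y\<in>used_nodes ?c. (x, y) \<in> (joined ?c)\<^sup>*"
  proof (rule connected_transfer[OF feas])
    fix l x y assume "0 < c l" "?c l = 0" and ends: "link_ends W l = {x, y}"
    then have "l \<in> rect_links i i' e f" using flip_pos[of l] by (cases "l = HLink (min i i') e") (auto simp: HLink_in_rect)
    then have "(x, Crossing i f) \<in> (joined ?c)\<^sup>*" "(y, Crossing i f) \<in> (joined ?c)\<^sup>*"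
      using flip_rect_node ends by auto
    then show "(x, y) \<in> (joined ?c)\<^sup>*" using joined_sym by (meson rtrancl_trans)
  next
    fix x assume x: "x \<in> used_nodes ?c"
    show "\<exists>y\<in>used_nodes c. (x, y) \<in> (joined ?c)\<^sup>*"
    proof (cases "x \<in> used_nodes c")
      case False
      then obtain l where l: "l \<in> links W" "0 < ?c l" "x \<in> link_ends W l" "c l = 0"
        using x by (auto simp: used_nodes_def)
      then have "l \<in> rect_links i i' e f" using flip_outside[of l] by fastforce
      then have "(x, Crossing i f) \<in> (joined ?c)\<^sup>*" using flip_rect_node l by auto
      moreover have "HLink (min i i') e \<in> rect_links i i' e f" by (simp add: HLink_in_rect)
      moreover from this have "Crossing i e \<in> used_nodes c"
        using hor rct rect_links_sub[OF rct] unfolding used_nodes_def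
        by (intro UnI2 UN_I[of "HLink (min i i') e"]) (auto simp: is_rect_def)
      ultimately show ?thesis
        using flip_corners[of i e] joined_sym by (meson rtrancl_trans)
    qed auto
  qed
  ultimately show ?thesis using flip_le_2 supp by (auto simp: feasible_def)
qed

lemma count_len_flip: "count_len (flip c i i' e f) \<le> count_len c"
proof -
  let ?c = "flip c i i' e f"
  \<comment> \<open>An upper bound for the change of the count; it is not attained where a count of 3 is
    replaced by 1.\<close>
  define d :: "link \<Rightarrow> real" where "d l = (case l of
      HLink b y \<Rightarrow> if b = min i i' \<and> y = e then - 1 else if b = min i i' \<and> y = f then 1 else 0
    | VLink b y s \<Rightarrow> if l \<in> rect_links i i' e f then if b = i then - 1 else 1 else 0)" for l
  have d: "real (?c l) \<le> real (c l) + d l" for l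
    using hor dbl by (cases l) (auto simp: d_def VLink_in_rect bump_def)
  have ne: "i \<noteq> i'" "e \<noteq> f" using rct by (auto simp: is_rect_def)
  have A: "(\<Sum>y\<in>{min e f..<max e f}. \<Sum>s\<le>stops b y. d (VLink b y s) * link_len W (VLink b y s)) =
      (if b = i then - 1 else 1) * (\<Sum>y\<in>{min e f..<max e f}. aisle_len W y)"
    if "b = i \<or> b = i'" for b
    using that unfolding sum_distrib_left sum_link_len[of b, symmetric]
    by (intro sum.cong) (auto simp: d_def VLink_in_rect)
  have "(\<Sum>l\<in>links W. d l * link_len W l) = 0"
  proof -
    have "(\<Sum>l\<in>links W. d l * link_len W l) =
      d (HLink (min i i') e) * link_len W (HLink (min i i') e) +
      d (HLink (min i i') f) * link_len W (HLink (min i i') f) +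
      (\<Sum>y\<in>{min e f..<max e f}. \<Sum>s\<le>stops i y. d (VLink i y s) * link_len W (VLink i y s)) +
      (\<Sum>y\<in>{min e f..<max e f}. \<Sum>s\<le>stops i' y. d (VLink i' y s) * link_len W (VLink i' y s))"
      by (rule sum_rect[OF rct]) (auto simp: d_def HLink_in_rect split: link.splits)
    then show ?thesis using A[of i] A[of i'] ne by (simp add: d_def)
  qed
  moreover have "count_len ?c \<le> (\<Sum>l\<in>links W. (real (c l) + d l) * link_len W l)"
    unfolding count_len_def using d link_len_nonneg by (intro sum_mono mult_right_mono) auto
  ultimately show ?thesis by (simp add: count_len_def distrib_right sum.distrib)
qed

text \<open>The doubled subaisles that the flip creates in aisle \<open>i'\<close> had a single edge before.\<close>

lemma potential_flip:
  assumes small: "(cross_aisles W + aisles W - i') *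
      card {y \<in> {min e f..<max e f}. \<forall>s\<le>stops i' y. c (VLink i' y s) = 1} <
      (cross_aisles W + aisles W - i) * (max e f - min e f)"
  shows "potential (flip c i i' e f) < potential c"
proof -
  let ?c = "flip c i i' e f" and ?I = "{min e f..<max e f}"
  let ?Q = "{y \<in> ?I. \<forall>s\<le>stops i' y. c (VLink i' y s) = 1}"
  let ?w = "\<lambda>b. cross_aisles W + aisles W - b"
  have ne: "i \<noteq> i'" using rct by (auto simp: is_rect_def)
  have "doubled c i = doubled ?c i \<union> ?I" "doubled ?c i \<inter> ?I = {}"
  proof -
    have "?I \<subseteq> doubled c i"
      using dbl rct by (auto simp: doubled_def is_subaisle_def is_rect_def)
    moreover have "y \<notin> doubled ?c i" if "y \<in> ?I" for y
      using that by (auto simp: doubled_def intro!: exI[of _ 0])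
    moreover have "y \<in> doubled ?c i \<longleftrightarrow> y \<in> doubled c i" if "y \<notin> ?I" for y
      using that by (auto simp: doubled_def)
    ultimately show "doubled c i = doubled ?c i \<union> ?I" "doubled ?c i \<inter> ?I = {}" by blast+
  qed
  then have i: "card (doubled c i) = card (doubled ?c i) + (max e f - min e f)"
    by (simp add: card_Un_disjoint finite_doubled)
  have "doubled ?c i' \<subseteq> doubled c i' \<union> ?Q"
  proof
    fix y assume y: "y \<in> doubled ?c i'"
    show "y \<in> doubled c i' \<union> ?Q"
    proof (cases "y \<in> ?I")
      case True
      have "bump (c (VLink i' y s)) = 2" if "s \<le> stops i' y" for s
        using y that True ne by (auto simp: doubled_def)
      then have "c (VLink i' y s) = 1" if "s \<le> stops i' y" for s
        using that by (fastforce simp: bump_def split: if_splits)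
      then show ?thesis using True by auto
    next
      case False
      then show ?thesis using y by (auto simp: doubled_def)
    qed
  qed
  then have "card (doubled ?c i') \<le> card (doubled c i' \<union> ?Q)"
    by (intro card_mono) (auto simp: finite_doubled)
  also have "\<dots> \<le> card (doubled c i') + card ?Q" by (rule card_Un_le)
  finally have "?w i' * card (doubled ?c i') \<le> ?w i' * (card (doubled c i') + card ?Q)"
    by (rule mult_le_mono2)
  then have i': "?w i' * card (doubled ?c i') \<le> ?w i' * card (doubled c i') + ?w i' * card ?Q"
    by (simp only: distrib_left)
  have o: "doubled ?c b = doubled c b" if "b \<noteq> i" "b \<noteq> i'" for b
    using that by (auto simp: doubled_def)
  have split: "potential a = ?w i * card (doubled a i) + ?w i' * card (doubled a i') +
      (\<Sum>b\<in>{1..aisles W} - {i, i'}. ?w b * card (doubled a b))" for a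
  proof -
    have "{i, i'} \<subseteq> {1..aisles W}" using rct by (auto simp: is_rect_def)
    then show ?thesis unfolding potential_def
      using ne by (subst sum.subset_diff[of "{i, i'}"]) auto
  qed
  have "(\<Sum>b\<in>{1..aisles W} - {i, i'}. ?w b * card (doubled ?c b)) =
      (\<Sum>b\<in>{1..aisles W} - {i, i'}. ?w b * card (doubled c b))"
    by (intro sum.cong) (auto simp: o)
  moreover have "?w i * card (doubled c i) =
      ?w i * card (doubled ?c i) + ?w i * (max e f - min e f)"
    unfolding i by (rule distrib_left)
  moreover have "A' + B' + C' < A + B + C" if "C' = C" "A = A' + d" "B' \<le> B + q" "q < d"
    for A A' B B' C C' d q :: nat
    using that by linarith
  ultimately show ?thesis unfolding split using i' small by blast
qed

end

text \<open>If the whole boundary of the rectangle is used and one of its two aisles is double, then a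
  double link of positive length can be dropped.\<close>

lemma remove_double_link:
  assumes feas: "feasible c" and rct: "is_rect i i' j k" and "j < k"
    and dbl: "\<And>y s. j \<le> y \<Longrightarrow> y < k \<Longrightarrow> s \<le> stops i y \<Longrightarrow> c (VLink i y s) = 2"
    and pos: "\<And>y s. j \<le> y \<Longrightarrow> y < k \<Longrightarrow> s \<le> stops i' y \<Longrightarrow> 0 < c (VLink i' y s)"
    and hor: "0 < c (HLink (min i i') j)" "0 < c (HLink (min i i') k)"
  shows "\<exists>c'. feasible c' \<and> count_len c' < count_len c"
proof -
  have sub: "is_subaisle W i j" using rct \<open>j < k\<close> by (auto simp: is_rect_def is_subaisle_def)
  then have "0 < (\<Sum>s\<le>stops i j. link_len W (VLink i j s))"
    unfolding sum_link_len using rect by (simp add: rectangular_warehouse_def is_subaisle_def)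
  then obtain s where s: "s \<le> stops i j" "0 < link_len W (VLink i j s)"
    by (metis atMost_iff not_less sum_nonpos)
  define l0 where "l0 = VLink i j s"
  define c' where "c' = c(l0 := 0)"
  have l0: "l0 \<in> links W" "c l0 = 2" using sub s dbl \<open>j < k\<close> by (auto simp: l0_def VLink_in_links)
  have cross: "(Crossing i y, Crossing i' y) \<in> (joined c')\<^sup>*" if "y = j \<or> y = k" for y
  proof -
    have "(Crossing (min i i') y, Crossing (Suc (min i i')) y) \<in> joined c'"
      using that hor rct by (intro joined_link[of "HLink (min i i') y"])
        (auto simp: c'_def l0_def HLink_in_links is_rect_def)
    then have "(Crossing (min i i') y, Crossing (Suc (min i i')) y) \<in> (joined c')\<^sup>*" by blast
    then show ?thesis using rct joined_sym[of "Crossing i' y" "Crossing i y" c']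
      by (auto simp: is_rect_def)
  qed
  \<comment> \<open>The rest of the boundary leads from one end of the dropped link to the other.\<close>
  have "(path i j ! 0, path i j ! s) \<in> (joined c')\<^sup>*"
    using sub s dbl \<open>j < k\<close> by (intro path_joined) (auto simp: c'_def l0_def)
  then have "(path i j ! s, Crossing i j) \<in> (joined c')\<^sup>*" using joined_sym by (simp add: path_0)
  also have "(Crossing i j, Crossing i' j) \<in> (joined c')\<^sup>*" using cross by simp
  also have "(Crossing i' j, Crossing i' k) \<in> (joined c')\<^sup>*"
    using rct pos \<open>j < k\<close> by (intro aisle_joined) (auto simp: is_rect_def c'_def l0_def)
  also have "(Crossing i' k, Crossing i k) \<in> (joined c')\<^sup>*" using cross joined_sym by simp
  also have "(Crossing i k, Crossing i (Suc j)) \<in> (joined c')\<^sup>*"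
    using rct dbl \<open>j < k\<close>
    by (intro joined_sym[OF aisle_joined]) (auto simp: is_rect_def c'_def l0_def)
  also have "(Crossing i (Suc j), path i j ! Suc s) \<in> (joined c')\<^sup>*"
    using path_joined[OF sub, of "Suc s" "Suc (stops i j)" c'] s dbl \<open>j < k\<close> joined_sym
    by (auto simp: c'_def l0_def path_end)
  finally have detour: "(path i j ! s, path i j ! Suc s) \<in> (joined c')\<^sup>*" .
  have "even (degree c' x)" for x
    using feas l0 by (intro even_degree_change[of c x c' "{}"]) (auto simp: feasible_def c'_def)
  moreover have "\<forall>x\<in>used_nodes c'. \<forall>y\<in>used_nodes c'. (x, y) \<in> (joined c')\<^sup>*"
  proof (rule connected_transfer[OF feas])
    fix l x y assume "0 < c l" "c' l = 0" and ends: "link_ends W l = {x, y}"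
    then have "l = l0" by (auto simp: c'_def split: if_splits)
    then have "{x, y} = {path i j ! s, path i j ! Suc s}" using ends by (simp add: l0_def)
    then show "(x, y) \<in> (joined c')\<^sup>*" using detour joined_sym by (auto simp: doubleton_eq_iff)
  next
    fix x assume "x \<in> used_nodes c'"
    then have "x \<in> used_nodes c" by (auto simp: used_nodes_def c'_def split: if_splits)
    then show "\<exists>y\<in>used_nodes c. (x, y) \<in> (joined c')\<^sup>*" by auto
  qed
  ultimately have "feasible c'" using feas by (auto simp: feasible_def c'_def)
  moreover have "count_len c' < count_len c"
    unfolding count_len_def
    using l0 s link_len_nonneg
    by (intro sum_strict_mono_ex1 finite_links) (auto simp: c'_def l0_def intro!: bexI[of _ l0])
  ultimately show ?thesis by blast
qed

section \<open>Connecting double edges\<close>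

lemma horizontal_count_pos:
  assumes "feasible c" "1 \<le> i" "0 < horizontal_count (graph_of c) i j"
  shows "0 < c (HLink (i - 1) j) \<or> 0 < c (HLink i j)"
proof -
  have *: "0 < c (HLink b j)" if m: "0 < mult (graph_of c) (Crossing b j) (Crossing b' j)"
    and b': "b' = Suc b" for b b'
  proof -
    obtain e where e: "e \<in> edges (graph_of c)" "link_ends W (fst e) = {Crossing b j, Crossing (Suc b) j}"
      using m b' by (auto simp: mult_def card_gt_0_iff graph_of_def)
    have l: "fst e \<in> links W" "0 < c (fst e)" using e(1) by (auto simp: graph_of_def split: if_splits)
    from l(1) show ?thesis
    proof (cases rule: link_cases)
      case (H a y)
      then show ?thesis using e l by (auto simp: doubleton_eq_iff)
    next
      case (V a y s)
      then have "Crossing b j \<in> link_ends W (VLink a y s)"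
          "Crossing (Suc b) j \<in> link_ends W (VLink a y s)"
        using e(2) by (metis insertI1, metis insertI1 insertI2)
      then show ?thesis
        using VLink_end_cases[OF V(2,3), of "Crossing b j"]
          VLink_end_cases[OF V(2,3), of "Crossing (Suc b) j"]
        by (auto simp del: link_ends.simps)
    qed
  qed
  have "0 < mult (graph_of c) (Crossing (i - 1) j) (Crossing i j) \<or>
      0 < mult (graph_of c) (Crossing i j) (Crossing (Suc i) j)"
    using assms(3) unfolding horizontal_count_def by (simp only: add_gr_0)
  moreover have "i = Suc (i - 1)" using assms(2) by simp
  ultimately show ?thesis using * by metis
qed

lemma subaisle_double_count:
  assumes "feasible c" "is_subaisle W i y" "subaisle_double W (graph_of c) i y" "s \<le> stops i y"
  shows "c (VLink i y s) = 2"
proof -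
  have "mult (graph_of c) (path i y ! s) (path i y ! Suc s) = link_count (graph_of c) (VLink i y s)"
    using assms by (intro mult_link graph_of_edges) (auto simp: VLink_in_links)
  then show ?thesis using assms by (simp add: subaisle_double_def link_count_graph_of)
qed

lemma no_connecting_double_edge:
  assumes feas: "feasible c"
    and len: "\<And>c'. feasible c' \<Longrightarrow> count_len c \<le> count_len c'"
    and pot: "\<And>c'. feasible c' \<Longrightarrow> count_len c' \<le> count_len c \<Longrightarrow> potential c \<le> potential c'"
  shows "\<not> connecting_double_edge W (graph_of c) i j k"
proof
  assume con: "connecting_double_edge W (graph_of c) i j k"
  let ?n = "cross_aisles W" and ?m = "aisles W"
  have b: "1 \<le> i" "i \<le> ?m" "1 \<le> j" "j < k" "k \<le> ?n"
    using con by (auto simp: connecting_double_edge_def double_edge_def)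
  have dbl: "c (VLink i y s) = 2" if "j \<le> y" "y < k" "s \<le> stops i y" for y s
    using that con b
    by (intro subaisle_double_count[OF feas])
      (auto simp: connecting_double_edge_def double_edge_def is_subaisle_def)
  have hj: "0 < c (HLink (i - 1) j) \<or> 0 < c (HLink i j)"
    and hk: "0 < c (HLink (i - 1) k) \<or> 0 < c (HLink i k)"
    using con horizontal_count_pos[OF feas b(1)] by (auto simp: connecting_double_edge_def)
  have supp: "l \<in> links W" if "0 < c l" for l using feas that by (auto simp: feasible_def)
  have noflip: "(?n + ?m - i) * (k - j) \<le>
      (?n + ?m - i') * card {y \<in> {j..<k}. \<forall>s\<le>stops i' y. c (VLink i' y s) = 1}"
    if "is_rect i i' e f" "min e f = j" "max e f = k" "0 < c (HLink (min i i') e)" for i' e f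
  proof (rule ccontr)
    have d: "\<And>y s. min e f \<le> y \<Longrightarrow> y < max e f \<Longrightarrow> s \<le> stops i y \<Longrightarrow> c (VLink i y s) = 2"
      using that(2,3) dbl by simp
    note fl = feasible_flip[OF feas that(1) d that(4)] count_len_flip[OF feas that(1) d that(4)]
      potential_flip[OF feas that(1) d that(4)]
    assume "\<not> ?thesis"
    then show False using fl pot[of "flip c i i' e f"] that by fastforce
  qed
  show False
  proof (cases "0 < c (HLink i j) \<or> 0 < c (HLink i k)")
    case True
    \<comment> \<open>The flip to the right that starts from the horizontal edge lowers the potential.\<close>
    then have m: "i < ?m" using supp[of "HLink i j"] supp[of "HLink i k"] by (auto simp: HLink_in_links)
    obtain e f where ef: "min e f = j" "max e f = k" "0 < c (HLink (min i (Suc i)) e)"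
      "is_rect i (Suc i) e f"
    proof (cases "0 < c (HLink i j)")
      case True
      then show ?thesis using that[of j k] b m by (auto simp: is_rect_def)
    next
      case False
      then show ?thesis using \<open>0 < c (HLink i j) \<or> 0 < c (HLink i k)\<close> that[of k j] b m
        by (auto simp: is_rect_def)
    qed
    let ?Q = "{y \<in> {j..<k}. \<forall>s\<le>stops (Suc i) y. c (VLink (Suc i) y s) = 1}"
    have "card ?Q \<le> card {j..<k}" by (intro card_mono) auto
    then have "card ?Q \<le> k - j" by simp
    then have "(?n + ?m - Suc i) * card ?Q \<le> (?n + ?m - Suc i) * (k - j)" by simp
    also have "\<dots> < (?n + ?m - i) * (k - j)" using b m by (intro mult_strict_right_mono) auto
    finally show False using noflip[OF ef(4,1-3)] by simp
  next
    case False
    then have h: "0 < c (HLink (i - 1) j)" "0 < c (HLink (i - 1) k)" using hj hk by auto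
    then have "1 \<le> i - 1" using supp[of "HLink (i - 1) j"] by (auto simp: HLink_in_links)
    then have r: "is_rect i (i - 1) j k" "min i (i - 1) = i - 1" using b by (auto simp: is_rect_def)
    let ?Q = "{y \<in> {j..<k}. \<forall>s\<le>stops (i - 1) y. c (VLink (i - 1) y s) = 1}"
    show False
    proof (cases "?Q = {j..<k}")
      case True
      \<comment> \<open>Aisle \<open>i - 1\<close> and both horizontal links are used.\<close>
      have "c (VLink (i - 1) y s) = 1" if "j \<le> y" "y < k" "s \<le> stops (i - 1) y" for y s
      proof -
        have "y \<in> ?Q" unfolding True using that by simp
        then show ?thesis using that by blast
      qed
      then have "\<exists>c'. feasible c' \<and> count_len c' < count_len c"
        using h r(2) b(4) dbl by (intro remove_double_link[OF feas r(1)]) auto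
      then show False using len by (meson not_less)
    next
      case False
      then have "?Q \<subset> {j..<k}" by auto
      then have "card ?Q < card {j..<k}" by (intro psubset_card_mono) auto
      then have "card ?Q \<le> k - j - 1" by simp
      then have "(?n + ?m - (i - 1)) * card ?Q \<le> (?n + ?m - (i - 1)) * (k - j - 1)" by simp
      also have "\<dots> < (?n + ?m - i) * (k - j)"
      proof -
        obtain w where w: "?n + ?m - i = w" "?n + ?m - (i - 1) = Suc w" "?n \<le> w"
          using b by auto
        obtain d where d: "k - j = Suc d" "d < ?n" using b by (cases "k - j") auto
        show ?thesis using w d by simp
      qed
      finally show False using noflip[of "i - 1" j k] r h b by simp
    qed
  qed
qed

lemma exists_minimum_without_connecting:
  "\<exists>T. minimum_tour_subgraph W T \<and> \<not> (\<exists>i j k. connecting_double_edge W T i j k)"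
proof -
  let ?F = "{c. feasible c}"
  have ne: "?F \<noteq> {}" using feasible_all by blast
  \<comment> \<open>Least length first, then least potential.\<close>
  define L where "L = Min (count_len ` ?F)"
  have L: "L \<le> count_len c" if "feasible c" for c
    unfolding L_def using that finite_feasible by (intro Min_le) auto
  have "L \<in> count_len ` ?F" unfolding L_def using finite_feasible ne by (intro Min_in) auto
  then have "\<exists>c. feasible c \<and> count_len c = L" by auto
  then obtain c where c: "feasible c" "count_len c = L"
    and pot: "\<And>c'. feasible c' \<and> count_len c' = L \<Longrightarrow> potential c \<le> potential c'"
    using ex_has_least_nat[of "\<lambda>c. feasible c \<and> count_len c = L" _ potential] by blast
  have "minimum_tour_subgraph W (graph_of c)" using c L by (intro minimum_graph_of) auto
  moreover have "\<not> connecting_double_edge W (graph_of c) i j k" for i j k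
    using c L pot by (intro no_connecting_double_edge) (auto intro: antisym)
  ultimately show ?thesis by blast
qed

end

theorem theorem1:
  fixes W :: warehouse
  assumes "rectangular_warehouse W"
  shows "\<exists>T. minimum_tour_subgraph W T \<and> \<not> (\<exists>i j k. connecting_double_edge W T i j k)"
proof -
  interpret rect_warehouse W by unfold_locales (rule assms)
  show ?thesis by (rule exists_minimum_without_connecting)
qed

end
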